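(* Let $(t:A\otimes A\to A\otimes A,\ e:A\to I)$ be a counital fusion morphism in a braided monoidal category $\mathcal C$, and let $m:=(e\otimes 1)t:A\otimes A\to A$. Assume that $e$ and $$A^{\otimes 3}\xrightarrow{\ 1\otimes t\ }A^{\otimes 3}\xrightarrow{\ b^{-1}\otimes 1\ }A^{\otimes 3}\xrightarrow{\ m\otimes 1\ }A^{\otimes 2}$$ are split epimorphisms. Then the category of modules over $(t,e)$ is monoidal in such a way that the evident forgetful functor to $\mathcal C$, $(Q,q)\mapsto Q$, is strict monoidal.
   Context: Conventions: $\otimes$ is the monoidal product, $I$ the unit, $b$ the braiding ($b=b_{A,A}$ where no subscript is given); composition is juxtaposition, $1$ denotes identities, associativity and unit isomorphisms are suppressed. A *counital fusion morphism* in $\mathcal C$ is a pair of morphisms $t:A\otimes A\to A\otimes A$ and $e:A\to I$ such that $(t\otimes 1)(b^{-1}\otimes 1)(1\otimes t)(b\otimes 1)(1\otimes t)=(1\otimes t)(t\otimes 1)$ on $A^{\otimes 3}$ and $(1\otimes e)t=1\otimes e$. A *module* over $(t,e)$ is an object $Q$ with a morphism $q:A\otimes Q\to A\otimes Q$ such that - $(t\otimes 1)(b^{-1}\otimes 1)(1\otimes q)(b\otimes 1)(1\otimes q)=(1\otimes q)(t\otimes 1)$ on $A\otimes A\otimes Q$; - $(e\otimes 1)q:A\otimes Q\to Q$ is a split epimorphism. A *morphism* of modules $(Q,q)\to(R,r)$ is a morphism $f:Q\to R$ in $\mathcal C$ with $(1\otimes f)q=r(1\otimes f)$. *)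

theory Defs
  imports Main
begin

section \<open>Categories\<close>

record ('o, 'm) category =
  Obj :: "'o set"
  Arr :: "'m set"
  Dom :: "'m \<Rightarrow> 'o"
  Cod :: "'m \<Rightarrow> 'o"
  Id :: "'o \<Rightarrow> 'm"  ("\<one>\<index>")
  Comp :: "'m \<Rightarrow> 'm \<Rightarrow> 'm"  (infixr "\<cdot>\<index>" 55)

definition Hom :: "('o, 'm, 'x) category_scheme \<Rightarrow> 'o \<Rightarrow> 'o \<Rightarrow> 'm set" where
  "Hom C X Y = {f \<in> Arr C. Dom C f = X \<and> Cod C f = Y}"

text \<open>The record fields are total functions; the axioms constrain them only on objects and on
  (composable) arrows. \<open>g \<cdot> f\<close> is \<open>g\<close> after \<open>f\<close>.\<close>

locale category =
  fixes C :: "('o, 'm, 'x) category_scheme" (structure)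
  assumes Dom_in_Obj: "f \<in> Arr C \<Longrightarrow> Dom C f \<in> Obj C"
    and Cod_in_Obj: "f \<in> Arr C \<Longrightarrow> Cod C f \<in> Obj C"
    and Id_in_Hom: "X \<in> Obj C \<Longrightarrow> \<one> X \<in> Hom C X X"
    and Comp_in_Hom: "\<lbrakk>f \<in> Hom C X Y; g \<in> Hom C Y Z\<rbrakk> \<Longrightarrow> g \<cdot> f \<in> Hom C X Z"
    and Comp_Id_right: "f \<in> Hom C X Y \<Longrightarrow> f \<cdot> \<one> X = f"
    and Comp_Id_left: "f \<in> Hom C X Y \<Longrightarrow> \<one> Y \<cdot> f = f"
    and Comp_assoc: "\<lbrakk>f \<in> Hom C W X; g \<in> Hom C X Y; h \<in> Hom C Y Z\<rbrakk>
      \<Longrightarrow> (h \<cdot> g) \<cdot> f = h \<cdot> (g \<cdot> f)"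

definition inverse_arrows :: "('o, 'm, 'x) category_scheme \<Rightarrow> 'm \<Rightarrow> 'm \<Rightarrow> bool" where
  "inverse_arrows C f g \<longleftrightarrow>
    f \<in> Arr C \<and> g \<in> Hom C (Cod C f) (Dom C f) \<and>
    Comp C g f = Id C (Dom C f) \<and> Comp C f g = Id C (Cod C f)"

definition is_iso :: "('o, 'm, 'x) category_scheme \<Rightarrow> 'm \<Rightarrow> bool" where
  "is_iso C f \<longleftrightarrow> (\<exists>g. inverse_arrows C f g)"

definition Inv :: "('o, 'm, 'x) category_scheme \<Rightarrow> 'm \<Rightarrow> 'm"  ("inv\<index> _" [81] 80) where
  "Inv C f = (THE g. inverse_arrows C f g)"

definition split_epi :: "('o, 'm, 'x) category_scheme \<Rightarrow> 'm \<Rightarrow> bool" where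
  "split_epi C f \<longleftrightarrow>
    f \<in> Arr C \<and> (\<exists>s \<in> Hom C (Cod C f) (Dom C f). Comp C f s = Id C (Cod C f))"


section \<open>Braided monoidal categories\<close>

record ('o, 'm) monoidal_category = "('o, 'm) category" +
  TensorO :: "'o \<Rightarrow> 'o \<Rightarrow> 'o"  (infix "\<otimes>\<^sub>o\<index>" 70)
  Tensor :: "'m \<Rightarrow> 'm \<Rightarrow> 'm"  (infix "\<otimes>\<index>" 70)
  Unit :: "'o"  ("\<I>\<index>")
  Assoc :: "'o \<Rightarrow> 'o \<Rightarrow> 'o \<Rightarrow> 'm"  ("\<alpha>\<index>")
  LUnit :: "'o \<Rightarrow> 'm"  ("\<lambda>\<^sub>l\<index>")
  RUnit :: "'o \<Rightarrow> 'm"  ("\<rho>\<^sub>r\<index>")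

locale monoidal_category = category C
  for C :: "('o, 'm, 'x) monoidal_category_scheme" (structure) +
  assumes TensorO_in_Obj: "\<lbrakk>X \<in> Obj C; Y \<in> Obj C\<rbrakk> \<Longrightarrow> X \<otimes>\<^sub>o Y \<in> Obj C"
    and Tensor_in_Hom: "\<lbrakk>f \<in> Hom C X X'; g \<in> Hom C Y Y'\<rbrakk>
      \<Longrightarrow> f \<otimes> g \<in> Hom C (X \<otimes>\<^sub>o Y) (X' \<otimes>\<^sub>o Y')"
    and Tensor_Id: "\<lbrakk>X \<in> Obj C; Y \<in> Obj C\<rbrakk> \<Longrightarrow> \<one> X \<otimes> \<one> Y = \<one> (X \<otimes>\<^sub>o Y)"
    and Tensor_Comp: "\<lbrakk>f \<in> Hom C X X'; f' \<in> Hom C X' X''; g \<in> Hom C Y Y'; g' \<in> Hom C Y' Y''\<rbrakk>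
      \<Longrightarrow> (f' \<cdot> f) \<otimes> (g' \<cdot> g) = (f' \<otimes> g') \<cdot> (f \<otimes> g)"
    and Unit_in_Obj: "\<I> \<in> Obj C"
    and Assoc_in_Hom: "\<lbrakk>X \<in> Obj C; Y \<in> Obj C; Z \<in> Obj C\<rbrakk>
      \<Longrightarrow> \<alpha> X Y Z \<in> Hom C ((X \<otimes>\<^sub>o Y) \<otimes>\<^sub>o Z) (X \<otimes>\<^sub>o (Y \<otimes>\<^sub>o Z))"
    and Assoc_iso: "\<lbrakk>X \<in> Obj C; Y \<in> Obj C; Z \<in> Obj C\<rbrakk> \<Longrightarrow> is_iso C (\<alpha> X Y Z)"
    and Assoc_natural: "\<lbrakk>f \<in> Hom C X X'; g \<in> Hom C Y Y'; h \<in> Hom C Z Z'\<rbrakk>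
      \<Longrightarrow> \<alpha> X' Y' Z' \<cdot> ((f \<otimes> g) \<otimes> h) = (f \<otimes> (g \<otimes> h)) \<cdot> \<alpha> X Y Z"
    and LUnit_in_Hom: "X \<in> Obj C \<Longrightarrow> \<lambda>\<^sub>l X \<in> Hom C (\<I> \<otimes>\<^sub>o X) X"
    and LUnit_iso: "X \<in> Obj C \<Longrightarrow> is_iso C (\<lambda>\<^sub>l X)"
    and LUnit_natural: "f \<in> Hom C X Y \<Longrightarrow> \<lambda>\<^sub>l Y \<cdot> (\<one> \<I> \<otimes> f) = f \<cdot> \<lambda>\<^sub>l X"
    and RUnit_in_Hom: "X \<in> Obj C \<Longrightarrow> \<rho>\<^sub>r X \<in> Hom C (X \<otimes>\<^sub>o \<I>) X"
    and RUnit_iso: "X \<in> Obj C \<Longrightarrow> is_iso C (\<rho>\<^sub>r X)"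
    and RUnit_natural: "f \<in> Hom C X Y \<Longrightarrow> \<rho>\<^sub>r Y \<cdot> (f \<otimes> \<one> \<I>) = f \<cdot> \<rho>\<^sub>r X"
    and pentagon: "\<lbrakk>W \<in> Obj C; X \<in> Obj C; Y \<in> Obj C; Z \<in> Obj C\<rbrakk>
      \<Longrightarrow> (\<one> W \<otimes> \<alpha> X Y Z) \<cdot> \<alpha> W (X \<otimes>\<^sub>o Y) Z \<cdot> (\<alpha> W X Y \<otimes> \<one> Z)
        = \<alpha> W X (Y \<otimes>\<^sub>o Z) \<cdot> \<alpha> (W \<otimes>\<^sub>o X) Y Z"
    and triangle: "\<lbrakk>X \<in> Obj C; Y \<in> Obj C\<rbrakk>
      \<Longrightarrow> (\<one> X \<otimes> \<lambda>\<^sub>l Y) \<cdot> \<alpha> X \<I> Y = \<rho>\<^sub>r X \<otimes> \<one> Y"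

record ('o, 'm) braided_monoidal_category = "('o, 'm) monoidal_category" +
  Braid :: "'o \<Rightarrow> 'o \<Rightarrow> 'm"  ("\<b>\<index>")

locale braided_monoidal_category = monoidal_category C
  for C :: "('o, 'm, 'x) braided_monoidal_category_scheme" (structure) +
  assumes Braid_in_Hom: "\<lbrakk>X \<in> Obj C; Y \<in> Obj C\<rbrakk> \<Longrightarrow> \<b> X Y \<in> Hom C (X \<otimes>\<^sub>o Y) (Y \<otimes>\<^sub>o X)"
    and Braid_iso: "\<lbrakk>X \<in> Obj C; Y \<in> Obj C\<rbrakk> \<Longrightarrow> is_iso C (\<b> X Y)"
    and Braid_natural: "\<lbrakk>f \<in> Hom C X X'; g \<in> Hom C Y Y'\<rbrakk>
      \<Longrightarrow> \<b> X' Y' \<cdot> (f \<otimes> g) = (g \<otimes> f) \<cdot> \<b> X Y"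
    and hexagon1: "\<lbrakk>X \<in> Obj C; Y \<in> Obj C; Z \<in> Obj C\<rbrakk>
      \<Longrightarrow> \<alpha> Y Z X \<cdot> \<b> X (Y \<otimes>\<^sub>o Z) \<cdot> \<alpha> X Y Z
        = (\<one> Y \<otimes> \<b> X Z) \<cdot> \<alpha> Y X Z \<cdot> (\<b> X Y \<otimes> \<one> Z)"
    and hexagon2: "\<lbrakk>X \<in> Obj C; Y \<in> Obj C; Z \<in> Obj C\<rbrakk>
      \<Longrightarrow> inv (\<alpha> Z X Y) \<cdot> \<b> (X \<otimes>\<^sub>o Y) Z \<cdot> inv (\<alpha> X Y Z)
        = (\<b> X Z \<otimes> \<one> Y) \<cdot> inv (\<alpha> X Z Y) \<cdot> (\<one> X \<otimes> \<b> Y Z)"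


section \<open>Strict monoidal functors\<close>

locale strict_monoidal_functor =
  source: monoidal_category M + target: monoidal_category N
  for M :: "('o, 'm, 'x) monoidal_category_scheme"
    and N :: "('p, 'n, 'y) monoidal_category_scheme"
    and Fo :: "'o \<Rightarrow> 'p" and Fa :: "'m \<Rightarrow> 'n" +
  assumes F_in_Obj: "X \<in> Obj M \<Longrightarrow> Fo X \<in> Obj N"
    and F_in_Hom: "f \<in> Hom M X Y \<Longrightarrow> Fa f \<in> Hom N (Fo X) (Fo Y)"
    and F_Id: "X \<in> Obj M \<Longrightarrow> Fa (\<one>\<^bsub>M\<^esub> X) = \<one>\<^bsub>N\<^esub> (Fo X)"
    and F_Comp: "\<lbrakk>f \<in> Hom M X Y; g \<in> Hom M Y Z\<rbrakk> \<Longrightarrow> Fa (g \<cdot>\<^bsub>M\<^esub> f) = Fa g \<cdot>\<^bsub>N\<^esub> Fa f"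
    and F_TensorO: "\<lbrakk>X \<in> Obj M; Y \<in> Obj M\<rbrakk> \<Longrightarrow> Fo (X \<otimes>\<^sub>o\<^bsub>M\<^esub> Y) = Fo X \<otimes>\<^sub>o\<^bsub>N\<^esub> Fo Y"
    and F_Tensor: "\<lbrakk>f \<in> Arr M; g \<in> Arr M\<rbrakk> \<Longrightarrow> Fa (f \<otimes>\<^bsub>M\<^esub> g) = Fa f \<otimes>\<^bsub>N\<^esub> Fa g"
    and F_Unit: "Fo \<I>\<^bsub>M\<^esub> = \<I>\<^bsub>N\<^esub>"
    and F_Assoc: "\<lbrakk>X \<in> Obj M; Y \<in> Obj M; Z \<in> Obj M\<rbrakk>
      \<Longrightarrow> Fa (\<alpha>\<^bsub>M\<^esub> X Y Z) = \<alpha>\<^bsub>N\<^esub> (Fo X) (Fo Y) (Fo Z)"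
    and F_LUnit: "X \<in> Obj M \<Longrightarrow> Fa (\<lambda>\<^sub>l\<^bsub>M\<^esub> X) = \<lambda>\<^sub>l\<^bsub>N\<^esub> (Fo X)"
    and F_RUnit: "X \<in> Obj M \<Longrightarrow> Fa (\<rho>\<^sub>r\<^bsub>M\<^esub> X) = \<rho>\<^sub>r\<^bsub>N\<^esub> (Fo X)"


section \<open>Counital fusion morphisms and their modules\<close>

text \<open>The associativity and unit isomorphisms that one usually suppresses are inserted explicitly:
  every triple product is bracketed to the left, so \<open>1 \<otimes> q\<close> on \<open>X \<otimes> Y \<otimes> Z\<close> is
  conjugated by associators, and \<open>e \<otimes> 1\<close> with values in \<open>\<I> \<otimes> Q\<close> is followed by the left
  unit isomorphism.\<close>

definition on_last_two ::
    "('o, 'm, 'x) braided_monoidal_category_scheme \<Rightarrow> 'o \<Rightarrow> 'o \<Rightarrow> 'o \<Rightarrow> 'm \<Rightarrow> 'm" where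
  "on_last_two C X Y Z q =
    Comp C (Inv C (Assoc C X Y Z)) (Comp C (Tensor C (Id C X) q) (Assoc C X Y Z))"

definition counit_left ::
    "('o, 'm, 'x) braided_monoidal_category_scheme \<Rightarrow> 'm \<Rightarrow> 'o \<Rightarrow> 'm" where
  "counit_left C e Q = Comp C (LUnit C Q) (Tensor C e (Id C Q))"

text \<open>Both the fusion equation (take \<open>Q = A\<close> and \<open>q = t\<close>) and the first module axiom have the
  following shape, as an identity of endomorphisms of \<open>(A \<otimes> A) \<otimes> Q\<close>.\<close>

definition fusion_equation ::
    "('o, 'm, 'x) braided_monoidal_category_scheme \<Rightarrow> 'o \<Rightarrow> 'm \<Rightarrow> 'o \<Rightarrow> 'm \<Rightarrow> bool" where
  "fusion_equation C A t Q q \<longleftrightarrow>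
    (let q23 = on_last_two C A A Q q; b = \<b>\<^bsub>C\<^esub> A A; i = \<one>\<^bsub>C\<^esub> Q in
      (t \<otimes>\<^bsub>C\<^esub> i) \<cdot>\<^bsub>C\<^esub> (inv\<^bsub>C\<^esub> b \<otimes>\<^bsub>C\<^esub> i) \<cdot>\<^bsub>C\<^esub> q23 \<cdot>\<^bsub>C\<^esub> (b \<otimes>\<^bsub>C\<^esub> i) \<cdot>\<^bsub>C\<^esub> q23
      = q23 \<cdot>\<^bsub>C\<^esub> (t \<otimes>\<^bsub>C\<^esub> i))"

definition counital_fusion_morphism ::
    "('o, 'm, 'x) braided_monoidal_category_scheme \<Rightarrow> 'o \<Rightarrow> 'm \<Rightarrow> 'm \<Rightarrow> bool" where
  "counital_fusion_morphism C A t e \<longleftrightarrow>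
    A \<in> Obj C \<and>
    t \<in> Hom C (A \<otimes>\<^sub>o\<^bsub>C\<^esub> A) (A \<otimes>\<^sub>o\<^bsub>C\<^esub> A) \<and>
    e \<in> Hom C A \<I>\<^bsub>C\<^esub> \<and>
    fusion_equation C A t A t \<and>
    (\<one>\<^bsub>C\<^esub> A \<otimes>\<^bsub>C\<^esub> e) \<cdot>\<^bsub>C\<^esub> t = \<one>\<^bsub>C\<^esub> A \<otimes>\<^bsub>C\<^esub> e"

definition fusion_mult ::
    "('o, 'm, 'x) braided_monoidal_category_scheme \<Rightarrow> 'o \<Rightarrow> 'm \<Rightarrow> 'm \<Rightarrow> 'm" where
  "fusion_mult C A t e = counit_left C e A \<cdot>\<^bsub>C\<^esub> t"

definition fusion_module ::
    "('o, 'm, 'x) braided_monoidal_category_scheme \<Rightarrow> 'o \<Rightarrow> 'm \<Rightarrow> 'm \<Rightarrow> 'o \<Rightarrow> 'm \<Rightarrow> bool" where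
  "fusion_module C A t e Q q \<longleftrightarrow>
    Q \<in> Obj C \<and>
    q \<in> Hom C (A \<otimes>\<^sub>o\<^bsub>C\<^esub> Q) (A \<otimes>\<^sub>o\<^bsub>C\<^esub> Q) \<and>
    fusion_equation C A t Q q \<and>
    split_epi C (counit_left C e Q \<cdot>\<^bsub>C\<^esub> q)"

definition fusion_module_morphism ::
    "('o, 'm, 'x) braided_monoidal_category_scheme \<Rightarrow> 'o \<Rightarrow> 'o \<times> 'm \<Rightarrow> 'o \<times> 'm \<Rightarrow> 'm \<Rightarrow> bool" where
  "fusion_module_morphism C A = (\<lambda>(Q, q) (R, r) f.
    f \<in> Hom C Q R \<and> (\<one>\<^bsub>C\<^esub> A \<otimes>\<^bsub>C\<^esub> f) \<cdot>\<^bsub>C\<^esub> q = r \<cdot>\<^bsub>C\<^esub> (\<one>\<^bsub>C\<^esub> A \<otimes>\<^bsub>C\<^esub> f))"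

text \<open>An arrow of the category of modules records its source and target modules, since the same
  underlying morphism may be a morphism between several pairs of modules.\<close>

type_synonym ('o, 'm) module_arrow = "('o \<times> 'm) \<times> 'm \<times> ('o \<times> 'm)"

definition module_category ::
    "('o, 'm, 'x) braided_monoidal_category_scheme \<Rightarrow> 'o \<Rightarrow> 'm \<Rightarrow> 'm
      \<Rightarrow> ('o \<times> 'm, ('o, 'm) module_arrow) category" where
  "module_category C A t e = \<lparr>
    Obj = {(Q, q). fusion_module C A t e Q q},
    Arr = {((Q, q), f, (R, r)) | Q q f R r.
      fusion_module C A t e Q q \<and> fusion_module C A t e R r \<and>
      fusion_module_morphism C A (Q, q) (R, r) f},
    Dom = (\<lambda>(X, f, Y). X),
    Cod = (\<lambda>(X, f, Y). Y),
    Id = (\<lambda>(Q, q). ((Q, q), \<one>\<^bsub>C\<^esub> Q, (Q, q))),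
    Comp = (\<lambda>(_, g, Z) (X, f, _). (X, g \<cdot>\<^bsub>C\<^esub> f, Z)) \<rparr>"

definition forget_obj :: "'o \<times> 'm \<Rightarrow> 'o" where
  "forget_obj = (\<lambda>(Q, q). Q)"

definition forget_arr :: "('o, 'm) module_arrow \<Rightarrow> 'm" where
  "forget_arr = (\<lambda>(X, f, Y). f)"

text \<open>\<open>category.truncate M\<close> is the underlying category of \<open>M\<close>, i.e. the record without its
  monoidal fields.\<close>

definition monoidal_structure_on ::
    "('o, 'm) category \<Rightarrow> ('o, 'm) monoidal_category \<Rightarrow> bool" where
  "monoidal_structure_on D M \<longleftrightarrow> monoidal_category M \<and> category.truncate M = D"

end

theory Submission
  imports Defs
begin

text \<open>
  Write \<open>ax\<close> for the action \<open>(e \<otimes> 1) q : A \<otimes> Q \<rightarrow> Q\<close> belonging to a module \<open>(Q, q)\<close>. When \<open>t\<close>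
  comes from a bialgebra, \<open>t (a \<otimes> b) = a\<^sub>1 \<otimes> a\<^sub>2 b\<close> and \<open>q (a \<otimes> x) = a\<^sub>1 \<otimes> a\<^sub>2 x\<close> in Sweedler
  notation; this dictates the tensor product of \<open>(Q, q)\<close> and \<open>(R, r)\<close>: on \<open>A \<otimes> Q \<otimes> R\<close> it is the
  endomorphism \<open>a \<otimes> x \<otimes> y \<mapsto> a\<^sub>1 \<otimes> a\<^sub>2 x \<otimes> a\<^sub>3 y\<close>, that is, \<open>q\<close> on the first two factors after
  \<open>r\<close> on the outer two, where \<open>A\<close> is braided past \<open>Q\<close> and back again. The unit is \<open>\<I>\<close> with the
  identity. Since the underlying objects and morphisms are tensored as in the ambient category,
  the forgetful functor is strict monoidal as soon as three things hold.

  The coherence isomorphisms are module morphisms. Both kinds of extension, of \<open>q\<close> by an object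
  on the right (\<open>whisker_right\<close>) and by an object on the left (\<open>whisker_left\<close>), are functorial,
  natural and compatible with iterated tensor products. The compatibilities with \<open>\<alpha>\<close>, \<open>\<lambda>\<^sub>l\<close> and
  \<open>\<rho>\<^sub>r\<close> follow formally (\<open>module_tensor_assoc\<close> and its companions).

  The tensor product satisfies the fusion equation. Each of the two whiskered factors satisfies
  it, because an isomorphism carries the whiskered equation to the original one tensored with an
  object (\<open>fusion_law_transport\<close>); and the factors commute in the sense needed to multiply the
  two equations (\<open>fusion_law_Comp\<close>).

  The action on the tensor product is a split epimorphism. This is where the hypothesis on
  \<open>a \<otimes> b \<otimes> c \<mapsto> b\<^sub>1 a \<otimes> b\<^sub>2 c\<close> enters. Postcomposing the fusion equation with the counit gives
  \<open>a\<^sub>1 \<otimes> a\<^sub>2 (b x) = a\<^sub>1 \<otimes> (a\<^sub>2 b) x\<close> (\<open>fusion_law_action\<close>), hence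
  \<open>b\<^sub>1 (a x) \<otimes> b\<^sub>2 (c y) = (b\<^sub>1 a) x \<otimes> (b\<^sub>2 c) y\<close>. The right-hand side is a composite of split
  epimorphisms in \<open>a, b, c, x, y\<close>; the left-hand side factors through the action of \<open>b\<close> on the
  tensor product, which is therefore a split epimorphism as well (\<open>split_epi_module_tensor\<close>).
  The action on the unit module is \<open>e\<close> up to a unit isomorphism, so there the hypothesis on \<open>e\<close>
  suffices.
\<close>

lemma Hom_iff [simp]: "f \<in> Hom C X Y \<longleftrightarrow> f \<in> Arr C \<and> Dom C f = X \<and> Cod C f = Y"
  by (auto simp: Hom_def)

section \<open>Categories\<close>

context category
begin

lemmas [simp] = Dom_in_Obj Cod_in_Obj

lemma Id_simps [simp]:
  assumes "X \<in> Obj C"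
  shows "\<one> X \<in> Arr C" "Dom C (\<one> X) = X" "Cod C (\<one> X) = X"
  using Id_in_Hom[OF assms] by auto

lemma Comp_simps [simp]:
  assumes "f \<in> Arr C" "g \<in> Arr C" "Cod C f = Dom C g"
  shows "g \<cdot> f \<in> Arr C" "Dom C (g \<cdot> f) = Dom C f" "Cod C (g \<cdot> f) = Cod C g"
  using Comp_in_Hom[of f "Dom C f" "Dom C g" g "Cod C g"] assms by auto

lemma Comp_Id [simp]:
  assumes "f \<in> Arr C"
  shows "Dom C f = X \<Longrightarrow> f \<cdot> \<one> X = f" "Cod C f = Y \<Longrightarrow> \<one> Y \<cdot> f = f"
  using Comp_Id_right[of f] Comp_Id_left[of f] assms by auto

lemma Comp_assoc' [simp]:
  assumes "f \<in> Arr C" "g \<in> Arr C" "h \<in> Arr C" "Cod C f = Dom C g" "Cod C g = Dom C h"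
  shows "(h \<cdot> g) \<cdot> f = h \<cdot> (g \<cdot> f)"
  using Comp_assoc[of f "Dom C f" "Dom C g" g "Dom C h" h "Cod C h"] assms by auto

text \<open>With composites normalised to associate to the right, an equation whose left-hand side is
  a composite does not match inside a longer composite; this rule supplies the variant that
  does.\<close>
lemma Comp_extend:
  assumes "g \<cdot> f = k" "f \<in> Arr C" "g \<in> Arr C" "x \<in> Arr C" "Cod C x = Dom C f" "Cod C f = Dom C g"
  shows "g \<cdot> (f \<cdot> x) = k \<cdot> x"
  using assms Comp_assoc' by metis

lemma inverse_arrows_unique:
  assumes "inverse_arrows C f g" "inverse_arrows C f h"
  shows "g = h"
proof -
  have "g = g \<cdot> (f \<cdot> h)" using assms by (auto simp: inverse_arrows_def)
  also have "\<dots> = (g \<cdot> f) \<cdot> h"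
    using assms by (intro Comp_assoc'[symmetric]) (auto simp: inverse_arrows_def)
  also have "\<dots> = \<one> (Dom C f) \<cdot> h" using assms by (simp only: inverse_arrows_def)
  also have "\<dots> = h" using assms by (auto simp: inverse_arrows_def)
  finally show ?thesis .
qed

lemma Inv_eqI: "inverse_arrows C f g \<Longrightarrow> inv f = g"
  unfolding Inv_def using inverse_arrows_unique by blast

lemma Inv_simps [simp]:
  assumes "is_iso C f"
  shows "inv f \<in> Arr C" "Dom C (inv f) = Cod C f" "Cod C (inv f) = Dom C f"
    "inv f \<cdot> f = \<one> (Dom C f)" "f \<cdot> inv f = \<one> (Cod C f)"
  using assms Inv_eqI unfolding is_iso_def by (auto simp: inverse_arrows_def)

lemma iso_Arr [dest]: "is_iso C f \<Longrightarrow> f \<in> Arr C"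
  by (auto simp: is_iso_def inverse_arrows_def)

lemma Inv_cancel [simp]:
  assumes "is_iso C f" "x \<in> Arr C"
  shows "Cod C x = Dom C f \<Longrightarrow> inv f \<cdot> (f \<cdot> x) = x"
    "Cod C x = Cod C f \<Longrightarrow> f \<cdot> (inv f \<cdot> x) = x"
  using assms Comp_extend[of "inv f" f] Comp_extend[of f "inv f"] by (auto dest: iso_Arr)

lemma iso_cancel_left:
  assumes "is_iso C f" "x \<in> Arr C" "y \<in> Arr C" "Cod C x = Dom C f" "Cod C y = Dom C f"
    "f \<cdot> x = f \<cdot> y"
  shows "x = y"
  using assms by (metis Inv_cancel(1))

lemma iso_cancel_right:
  assumes "is_iso C f" "x \<in> Arr C" "y \<in> Arr C" "Dom C x = Cod C f" "Dom C y = Cod C f"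
    "x \<cdot> f = y \<cdot> f"
  shows "x = y"
proof -
  have "x = (x \<cdot> f) \<cdot> inv f" using assms(1-5) iso_Arr by simp
  also have "\<dots> = (y \<cdot> f) \<cdot> inv f" using assms(6) by simp
  also have "\<dots> = y" using assms(1-5) iso_Arr by simp
  finally show ?thesis .
qed

lemma isoI:
  assumes "f \<in> Arr C" "g \<in> Arr C" "Dom C g = Cod C f" "Cod C g = Dom C f"
    "g \<cdot> f = \<one> (Dom C f)" "f \<cdot> g = \<one> (Cod C f)"
  shows "is_iso C f" "inv f = g"
  using assms Inv_eqI[of f g] unfolding is_iso_def by (auto simp: inverse_arrows_def)

lemma iso_Comp [simp]:
  assumes "is_iso C f" "is_iso C g" "Cod C f = Dom C g"
  shows "is_iso C (g \<cdot> f)"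
  using assms iso_Arr[of f] iso_Arr[of g] isoI(1)[of "g \<cdot> f" "inv f \<cdot> inv g"] by simp

lemma iso_Inv [simp]: "is_iso C f \<Longrightarrow> is_iso C (inv f)"
  by (rule isoI(1)[of _ f]) (auto dest: iso_Arr)

lemma iso_Id [simp]: "X \<in> Obj C \<Longrightarrow> is_iso C (\<one> X)"
  by (rule isoI(1)[of _ "\<one> X"]) auto

text \<open>An intertwining relation can be read backwards along isomorphisms.\<close>
lemma intertwine_Inv:
  assumes "is_iso C s" "is_iso C s'" "x \<in> Arr C" "y \<in> Arr C"
    "Cod C x = Dom C s'" "Dom C y = Cod C s" "Dom C x = Dom C s" "Cod C y = Cod C s'"
    "s' \<cdot> x = y \<cdot> s"
  shows "inv s' \<cdot> y = x \<cdot> inv s"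
proof -
  have "inv s' \<cdot> y = inv s' \<cdot> ((y \<cdot> s) \<cdot> inv s)" using assms(1-8) iso_Arr by simp
  also have "\<dots> = inv s' \<cdot> ((s' \<cdot> x) \<cdot> inv s)" using assms(9) by simp
  also have "\<dots> = x \<cdot> inv s" using assms(1-8) iso_Arr by simp
  finally show ?thesis .
qed

lemma split_epi_Comp:
  assumes "split_epi C f" "split_epi C g" "Cod C f = Dom C g"
  shows "split_epi C (g \<cdot> f)"
proof -
  obtain s u where "s \<in> Arr C" "Dom C s = Cod C f" "Cod C s = Dom C f" "f \<cdot> s = \<one> (Cod C f)"
    "u \<in> Arr C" "Dom C u = Cod C g" "Cod C u = Dom C g" "g \<cdot> u = \<one> (Cod C g)"
    "f \<in> Arr C" "g \<in> Arr C"
    using assms unfolding split_epi_def by auto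
  then show ?thesis unfolding split_epi_def using assms(3)
    by (auto intro!: bexI[of _ "s \<cdot> u"] simp: Comp_extend[of f s])
qed

text \<open>If a composite has a section, then so has its last factor.\<close>
lemma split_epi_Comp_left:
  assumes "split_epi C (g \<cdot> f)" "f \<in> Arr C" "g \<in> Arr C" "Cod C f = Dom C g"
  shows "split_epi C g"
proof -
  obtain s where "s \<in> Arr C" "Dom C s = Cod C g" "Cod C s = Dom C f" "g \<cdot> (f \<cdot> s) = \<one> (Cod C g)"
    using assms unfolding split_epi_def by auto
  then show ?thesis unfolding split_epi_def using assms(2-4)
    by (auto intro!: bexI[of _ "f \<cdot> s"])
qed

lemma split_epi_iso: "is_iso C f \<Longrightarrow> split_epi C f"
  unfolding split_epi_def using iso_Arr by (auto intro!: bexI[of _ "inv f"])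

end

section \<open>Monoidal categories\<close>

context monoidal_category
begin

lemmas [simp] = TensorO_in_Obj Tensor_Id Unit_in_Obj Assoc_iso LUnit_iso RUnit_iso

lemma Tensor_simps [simp]:
  assumes "f \<in> Arr C" "g \<in> Arr C"
  shows "f \<otimes> g \<in> Arr C" "Dom C (f \<otimes> g) = Dom C f \<otimes>\<^sub>o Dom C g"
    "Cod C (f \<otimes> g) = Cod C f \<otimes>\<^sub>o Cod C g"
  using Tensor_in_Hom[of f _ _ g] assms by auto

lemma Assoc_simps [simp]:
  assumes "X \<in> Obj C" "Y \<in> Obj C" "Z \<in> Obj C"
  shows "\<alpha> X Y Z \<in> Arr C" "Dom C (\<alpha> X Y Z) = (X \<otimes>\<^sub>o Y) \<otimes>\<^sub>o Z"
    "Cod C (\<alpha> X Y Z) = X \<otimes>\<^sub>o (Y \<otimes>\<^sub>o Z)"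
  using Assoc_in_Hom[OF assms] by auto

lemma LUnit_simps [simp]:
  assumes "X \<in> Obj C"
  shows "\<lambda>\<^sub>l X \<in> Arr C" "Dom C (\<lambda>\<^sub>l X) = \<I> \<otimes>\<^sub>o X" "Cod C (\<lambda>\<^sub>l X) = X"
  using LUnit_in_Hom[OF assms] by auto

lemma RUnit_simps [simp]:
  assumes "X \<in> Obj C"
  shows "\<rho>\<^sub>r X \<in> Arr C" "Dom C (\<rho>\<^sub>r X) = X \<otimes>\<^sub>o \<I>" "Cod C (\<rho>\<^sub>r X) = X"
  using RUnit_in_Hom[OF assms] by auto

lemma interchange [simp]:
  assumes "f \<in> Arr C" "f' \<in> Arr C" "g \<in> Arr C" "g' \<in> Arr C"
    "Cod C f = Dom C f'" "Cod C g = Dom C g'"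
  shows "(f' \<otimes> g') \<cdot> (f \<otimes> g) = (f' \<cdot> f) \<otimes> (g' \<cdot> g)"
  using Tensor_Comp[of f "Dom C f" "Dom C f'" f' "Cod C f'" g "Dom C g" "Dom C g'" g'
    "Cod C g'"] assms
  by auto

lemma interchange_pre [simp]:
  assumes "f \<in> Arr C" "f' \<in> Arr C" "g \<in> Arr C" "g' \<in> Arr C"
    "Cod C f = Dom C f'" "Cod C g = Dom C g'" "x \<in> Arr C" "Cod C x = Dom C f \<otimes>\<^sub>o Dom C g"
  shows "(f' \<otimes> g') \<cdot> ((f \<otimes> g) \<cdot> x) = ((f' \<cdot> f) \<otimes> (g' \<cdot> g)) \<cdot> x"
  using Comp_extend[OF interchange, of f f' g g' x] assms by auto

lemma iso_Tensor [simp]: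
  assumes "is_iso C f" "is_iso C g"
  shows "is_iso C (f \<otimes> g)" "inv (f \<otimes> g) = inv f \<otimes> inv g"
  using assms iso_Arr isoI[of "f \<otimes> g" "inv f \<otimes> inv g"] by simp_all

lemma Assoc_nat:
  assumes "f \<in> Arr C" "g \<in> Arr C" "h \<in> Arr C" "Cod C f = X" "Cod C g = Y" "Cod C h = Z"
  shows "\<alpha> X Y Z \<cdot> ((f \<otimes> g) \<otimes> h) = (f \<otimes> (g \<otimes> h)) \<cdot> \<alpha> (Dom C f) (Dom C g) (Dom C h)"
  using Assoc_natural[of f _ _ g _ _ h] assms by simp

lemma Assoc_nat_right:
  assumes "h \<in> Arr C" "X \<in> Obj C" "Y \<in> Obj C" "Cod C h = Z"
  shows "\<alpha> X Y Z \<cdot> (\<one> (X \<otimes>\<^sub>o Y) \<otimes> h) = (\<one> X \<otimes> (\<one> Y \<otimes> h)) \<cdot> \<alpha> X Y (Dom C h)"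
  using Assoc_nat[of "\<one> X" "\<one> Y" h X Y Z] assms by simp

lemma Assoc_nat_left:
  assumes "f \<in> Arr C" "Y \<in> Obj C" "Z \<in> Obj C" "Cod C f = X"
  shows "\<alpha> X Y Z \<cdot> ((f \<otimes> \<one> Y) \<otimes> \<one> Z) = (f \<otimes> \<one> (Y \<otimes>\<^sub>o Z)) \<cdot> \<alpha> (Dom C f) Y Z"
  using Assoc_nat[of f "\<one> Y" "\<one> Z" X Y Z] assms by simp

lemma LUnit_nat:
  assumes "f \<in> Arr C" "Cod C f = Y"
  shows "\<lambda>\<^sub>l Y \<cdot> (\<one> \<I> \<otimes> f) = f \<cdot> \<lambda>\<^sub>l (Dom C f)"
  using LUnit_natural[of f] assms by simp

lemma RUnit_nat:
  assumes "f \<in> Arr C" "Cod C f = Y"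
  shows "\<rho>\<^sub>r Y \<cdot> (f \<otimes> \<one> \<I>) = f \<cdot> \<rho>\<^sub>r (Dom C f)"
  using RUnit_natural[of f] assms by simp

text \<open>Naturality of \<open>\<lambda>\<^sub>l\<close> expresses \<open>f\<close> through \<open>\<one> \<I> \<otimes> f\<close>. This lets unit laws be checked after
  tensoring with \<open>\<I>\<close>, where the triangle axiom becomes applicable.\<close>
lemma unit_tensor_faithful:
  assumes "f \<in> Arr C" "g \<in> Arr C" "Dom C f = Dom C g" "Cod C f = Cod C g"
    "\<one> \<I> \<otimes> f = \<one> \<I> \<otimes> g"
  shows "f = g"
proof (rule iso_cancel_right[of "\<lambda>\<^sub>l (Dom C f)"])
  show "f \<cdot> \<lambda>\<^sub>l (Dom C f) = g \<cdot> \<lambda>\<^sub>l (Dom C f)"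
    using assms LUnit_nat by metis
qed (use assms in simp_all)

lemma tensor_unit_faithful:
  assumes "f \<in> Arr C" "g \<in> Arr C" "Dom C f = Dom C g" "Cod C f = Cod C g"
    "f \<otimes> \<one> \<I> = g \<otimes> \<one> \<I>"
  shows "f = g"
proof (rule iso_cancel_right[of "\<rho>\<^sub>r (Dom C f)"])
  show "f \<cdot> \<rho>\<^sub>r (Dom C f) = g \<cdot> \<rho>\<^sub>r (Dom C f)"
    using assms RUnit_nat by metis
qed (use assms in simp_all)

text \<open>Kelly's argument: tensored with \<open>\<I>\<close> on the left, the two sides agree by the pentagon for
  \<open>\<I>, \<I>, X, Y\<close> and two instances of the triangle.\<close>
lemma LUnit_Tensor:
  assumes [simp]: "X \<in> Obj C" "Y \<in> Obj C"
  shows "\<lambda>\<^sub>l (X \<otimes>\<^sub>o Y) \<cdot> \<alpha> \<I> X Y = \<lambda>\<^sub>l X \<otimes> \<one> Y"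
proof (rule unit_tensor_faithful)
  let ?p = "\<alpha> \<I> (\<I> \<otimes>\<^sub>o X) Y \<cdot> (\<alpha> \<I> \<I> X \<otimes> \<one> Y)"
  show "\<one> \<I> \<otimes> (\<lambda>\<^sub>l (X \<otimes>\<^sub>o Y) \<cdot> \<alpha> \<I> X Y) = \<one> \<I> \<otimes> (\<lambda>\<^sub>l X \<otimes> \<one> Y)"
  proof (rule iso_cancel_right[of ?p])
    have "(\<one> \<I> \<otimes> (\<lambda>\<^sub>l (X \<otimes>\<^sub>o Y) \<cdot> \<alpha> \<I> X Y)) \<cdot> ?p
        = (\<one> \<I> \<otimes> \<lambda>\<^sub>l (X \<otimes>\<^sub>o Y)) \<cdot> ((\<one> \<I> \<otimes> \<alpha> \<I> X Y) \<cdot> ?p)" by simp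
    also have "\<dots> = (\<one> \<I> \<otimes> \<lambda>\<^sub>l (X \<otimes>\<^sub>o Y)) \<cdot> (\<alpha> \<I> \<I> (X \<otimes>\<^sub>o Y) \<cdot> \<alpha> (\<I> \<otimes>\<^sub>o \<I>) X Y)"
      by (simp add: pentagon)
    also have "\<dots> = (\<rho>\<^sub>r \<I> \<otimes> \<one> (X \<otimes>\<^sub>o Y)) \<cdot> \<alpha> (\<I> \<otimes>\<^sub>o \<I>) X Y"
      by (simp add: triangle[THEN Comp_extend] del: interchange interchange_pre)
    also have "\<dots> = \<alpha> \<I> X Y \<cdot> (((\<one> \<I> \<otimes> \<lambda>\<^sub>l X) \<cdot> \<alpha> \<I> \<I> X) \<otimes> \<one> Y)"
      by (simp add: Assoc_nat_left triangle)
    also have "\<dots> = \<alpha> \<I> X Y \<cdot> (((\<one> \<I> \<otimes> \<lambda>\<^sub>l X) \<otimes> \<one> Y) \<cdot> (\<alpha> \<I> \<I> X \<otimes> \<one> Y))"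
      by simp
    also have "\<dots> = (\<one> \<I> \<otimes> (\<lambda>\<^sub>l X \<otimes> \<one> Y)) \<cdot> ?p"
      by (simp add: Assoc_nat[THEN Comp_extend] del: interchange)
    finally show "(\<one> \<I> \<otimes> (\<lambda>\<^sub>l (X \<otimes>\<^sub>o Y) \<cdot> \<alpha> \<I> X Y)) \<cdot> ?p = (\<one> \<I> \<otimes> (\<lambda>\<^sub>l X \<otimes> \<one> Y)) \<cdot> ?p" .
  qed simp_all
qed simp_all

text \<open>The mirror image of the previous argument, with the pentagon for \<open>X, Y, \<I>, \<I>\<close>.\<close>
lemma RUnit_Tensor:
  assumes [simp]: "X \<in> Obj C" "Y \<in> Obj C"
  shows "(\<one> X \<otimes> \<rho>\<^sub>r Y) \<cdot> \<alpha> X Y \<I> = \<rho>\<^sub>r (X \<otimes>\<^sub>o Y)"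
proof (rule tensor_unit_faithful)
  show "((\<one> X \<otimes> \<rho>\<^sub>r Y) \<cdot> \<alpha> X Y \<I>) \<otimes> \<one> \<I> = \<rho>\<^sub>r (X \<otimes>\<^sub>o Y) \<otimes> \<one> \<I>"
  proof (rule iso_cancel_left[of "\<alpha> X Y \<I>"])
    have "\<alpha> X Y \<I> \<cdot> (((\<one> X \<otimes> \<rho>\<^sub>r Y) \<cdot> \<alpha> X Y \<I>) \<otimes> \<one> \<I>)
        = \<alpha> X Y \<I> \<cdot> (((\<one> X \<otimes> \<rho>\<^sub>r Y) \<otimes> \<one> \<I>) \<cdot> (\<alpha> X Y \<I> \<otimes> \<one> \<I>))" by simp
    also have "\<dots> = (\<one> X \<otimes> (\<rho>\<^sub>r Y \<otimes> \<one> \<I>)) \<cdot> \<alpha> X (Y \<otimes>\<^sub>o \<I>) \<I> \<cdot> (\<alpha> X Y \<I> \<otimes> \<one> \<I>)"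
      by (simp add: Assoc_nat[THEN Comp_extend] del: interchange)
    also have "\<dots> = (\<one> X \<otimes> (\<one> Y \<otimes> \<lambda>\<^sub>l \<I>)) \<cdot> (\<one> X \<otimes> \<alpha> Y \<I> \<I>) \<cdot> \<alpha> X (Y \<otimes>\<^sub>o \<I>) \<I> \<cdot> (\<alpha> X Y \<I> \<otimes> \<one> \<I>)"
      by (simp add: triangle)
    also have "\<dots> = (\<one> X \<otimes> (\<one> Y \<otimes> \<lambda>\<^sub>l \<I>)) \<cdot> \<alpha> X Y (\<I> \<otimes>\<^sub>o \<I>) \<cdot> \<alpha> (X \<otimes>\<^sub>o Y) \<I> \<I>"
      by (simp add: pentagon del: interchange interchange_pre)
    also have "\<dots> = \<alpha> X Y \<I> \<cdot> (\<one> (X \<otimes>\<^sub>o Y) \<otimes> \<lambda>\<^sub>l \<I>) \<cdot> \<alpha> (X \<otimes>\<^sub>o Y) \<I> \<I>"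
      by (simp add: Assoc_nat_right[THEN Comp_extend])
    also have "\<dots> = \<alpha> X Y \<I> \<cdot> (\<rho>\<^sub>r (X \<otimes>\<^sub>o Y) \<otimes> \<one> \<I>)"
      by (simp add: triangle)
    finally show "\<alpha> X Y \<I> \<cdot> (((\<one> X \<otimes> \<rho>\<^sub>r Y) \<cdot> \<alpha> X Y \<I>) \<otimes> \<one> \<I>) = \<alpha> X Y \<I> \<cdot> (\<rho>\<^sub>r (X \<otimes>\<^sub>o Y) \<otimes> \<one> \<I>)" .
  qed simp_all
qed simp_all

lemma split_epi_Tensor:
  assumes "split_epi C f" "split_epi C g"
  shows "split_epi C (f \<otimes> g)"
proof -
  obtain s u where "s \<in> Arr C" "Dom C s = Cod C f" "Cod C s = Dom C f" "f \<cdot> s = \<one> (Cod C f)"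
    "u \<in> Arr C" "Dom C u = Cod C g" "Cod C u = Dom C g" "g \<cdot> u = \<one> (Cod C g)"
    "f \<in> Arr C" "g \<in> Arr C"
    using assms unfolding split_epi_def by auto
  then show ?thesis unfolding split_epi_def
    by (auto intro!: bexI[of _ "s \<otimes> u"])
qed

end

section \<open>Moving objects past each other in a braided monoidal category\<close>

context braided_monoidal_category
begin

lemmas [simp] = Braid_iso

lemma Braid_simps [simp]:
  assumes "X \<in> Obj C" "Y \<in> Obj C"
  shows "\<b> X Y \<in> Arr C" "Dom C (\<b> X Y) = X \<otimes>\<^sub>o Y" "Cod C (\<b> X Y) = Y \<otimes>\<^sub>o X"
  using Braid_in_Hom[OF assms] by auto

text \<open>Right-nested triple products are used throughout, since a module structure on \<open>Q\<close> is an
  endomorphism of \<open>A \<otimes> Q\<close> and the fusion equation for it lives on \<open>A \<otimes> (A \<otimes> Q)\<close>. The braiding of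
  the first two factors is then conjugated by associators; all further arguments use only the
  rules for \<open>swap\<close> below, in which the hexagons and most pentagons are absorbed.\<close>
definition swap where
  "swap W X Y = \<alpha> X W Y \<cdot> (\<b> W X \<otimes> \<one> Y) \<cdot> inv (\<alpha> W X Y)"

lemma swap_simps [simp]:
  assumes "W \<in> Obj C" "X \<in> Obj C" "Y \<in> Obj C"
  shows "swap W X Y \<in> Arr C" "Dom C (swap W X Y) = W \<otimes>\<^sub>o (X \<otimes>\<^sub>o Y)"
    "Cod C (swap W X Y) = X \<otimes>\<^sub>o (W \<otimes>\<^sub>o Y)" "is_iso C (swap W X Y)"
  using assms by (simp_all add: swap_def)

lemma swap_Assoc:
  assumes "W \<in> Obj C" "X \<in> Obj C" "Y \<in> Obj C"
  shows "swap W X Y \<cdot> \<alpha> W X Y = \<alpha> X W Y \<cdot> (\<b> W X \<otimes> \<one> Y)"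
  using assms by (simp add: swap_def)

lemma swap_nat:
  assumes [simp]: "f \<in> Arr C" "g \<in> Arr C" "h \<in> Arr C"
    and [symmetric, simp]: "Cod C f = W" "Cod C g = X" "Cod C h = Y"
  shows "swap W X Y \<cdot> (f \<otimes> (g \<otimes> h)) = (g \<otimes> (f \<otimes> h)) \<cdot> swap (Dom C f) (Dom C g) (Dom C h)"
proof (rule iso_cancel_right[of "\<alpha> (Dom C f) (Dom C g) (Dom C h)"])
  have b: "\<b> (Cod C f) (Cod C g) \<cdot> (f \<otimes> g) = (g \<otimes> f) \<cdot> \<b> (Dom C f) (Dom C g)"
    using Braid_natural[of f _ _ g] by simp
  have "(swap W X Y \<cdot> (f \<otimes> (g \<otimes> h))) \<cdot> \<alpha> (Dom C f) (Dom C g) (Dom C h)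
      = swap W X Y \<cdot> \<alpha> W X Y \<cdot> ((f \<otimes> g) \<otimes> h)"
    by (simp add: Assoc_nat)
  also have "\<dots> = \<alpha> X W Y \<cdot> ((\<b> W X \<cdot> (f \<otimes> g)) \<otimes> h)"
    by (simp add: swap_Assoc[THEN Comp_extend])
  also have "\<dots> = \<alpha> X W Y \<cdot> ((g \<otimes> f) \<otimes> h) \<cdot> (\<b> (Dom C f) (Dom C g) \<otimes> \<one> (Dom C h))"
    by (simp add: b)
  also have "\<dots> = ((g \<otimes> (f \<otimes> h)) \<cdot> swap (Dom C f) (Dom C g) (Dom C h))
    \<cdot> \<alpha> (Dom C f) (Dom C g) (Dom C h)"
    by (simp add: Assoc_nat[THEN Comp_extend] swap_Assoc del: interchange)
  finally show "(swap W X Y \<cdot> (f \<otimes> (g \<otimes> h))) \<cdot> \<alpha> (Dom C f) (Dom C g) (Dom C h)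
    = ((g \<otimes> (f \<otimes> h)) \<cdot> swap (Dom C f) (Dom C g) (Dom C h)) \<cdot> \<alpha> (Dom C f) (Dom C g) (Dom C h)" .
qed simp_all

text \<open>The first hexagon, with a spectator \<open>Y\<close> on the right. Precomposing with the isomorphism
  \<open>?P\<close> replaces every \<open>swap\<close> by a braiding, and pentagons then bring both sides to a common form
  ending in \<open>?M\<close>.\<close>
lemma swap_Tensor_middle:
  assumes [simp]: "W \<in> Obj C" "U \<in> Obj C" "V \<in> Obj C" "Y \<in> Obj C"
  shows "\<alpha> U V (W \<otimes>\<^sub>o Y) \<cdot> swap W (U \<otimes>\<^sub>o V) Y
    = (\<one> U \<otimes> swap W V Y) \<cdot> swap W U (V \<otimes>\<^sub>o Y) \<cdot> (\<one> W \<otimes> \<alpha> U V Y)"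
proof (rule iso_cancel_right[of "\<alpha> W (U \<otimes>\<^sub>o V) Y \<cdot> (\<alpha> W U V \<otimes> \<one> Y)"])
  let ?P = "\<alpha> W (U \<otimes>\<^sub>o V) Y \<cdot> (\<alpha> W U V \<otimes> \<one> Y)"
  let ?M = "\<alpha> U (W \<otimes>\<^sub>o V) Y \<cdot> (\<alpha> U W V \<otimes> \<one> Y) \<cdot> ((\<b> W U \<otimes> \<one> V) \<otimes> \<one> Y)"
  have "(\<alpha> U V (W \<otimes>\<^sub>o Y) \<cdot> swap W (U \<otimes>\<^sub>o V) Y) \<cdot> ?P
      = (\<alpha> U V (W \<otimes>\<^sub>o Y) \<cdot> \<alpha> (U \<otimes>\<^sub>o V) W Y) \<cdot> ((\<b> W (U \<otimes>\<^sub>o V) \<cdot> \<alpha> W U V) \<otimes> \<one> Y)"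
    by (simp add: swap_Assoc[THEN Comp_extend])
  also have "\<dots> = (\<one> U \<otimes> \<alpha> V W Y) \<cdot> \<alpha> U (V \<otimes>\<^sub>o W) Y \<cdot> ((\<alpha> U V W \<cdot> \<b> W (U \<otimes>\<^sub>o V) \<cdot> \<alpha> W U V) \<otimes> \<one> Y)"
    by (simp add: pentagon[symmetric] del: Comp_assoc') (simp add: Comp_assoc')
  also have "\<dots> = (\<one> U \<otimes> \<alpha> V W Y) \<cdot> \<alpha> U (V \<otimes>\<^sub>o W) Y \<cdot> ((\<one> U \<otimes> \<b> W V) \<otimes> \<one> Y)
    \<cdot> ((\<alpha> U W V \<cdot> (\<b> W U \<otimes> \<one> V)) \<otimes> \<one> Y)"
    by (simp add: hexagon1)
  also have "\<dots> = (\<one> U \<otimes> (swap W V Y \<cdot> \<alpha> W V Y)) \<cdot> ?M"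
    by (simp add: Assoc_nat[THEN Comp_extend] swap_Assoc del: interchange) simp
  finally have L: "(\<alpha> U V (W \<otimes>\<^sub>o Y) \<cdot> swap W (U \<otimes>\<^sub>o V) Y) \<cdot> ?P
    = (\<one> U \<otimes> (swap W V Y \<cdot> \<alpha> W V Y)) \<cdot> ?M" .
  have "((\<one> U \<otimes> swap W V Y) \<cdot> swap W U (V \<otimes>\<^sub>o Y) \<cdot> (\<one> W \<otimes> \<alpha> U V Y)) \<cdot> ?P
    = (\<one> U \<otimes> swap W V Y) \<cdot> swap W U (V \<otimes>\<^sub>o Y) \<cdot> \<alpha> W U (V \<otimes>\<^sub>o Y) \<cdot> \<alpha> (W \<otimes>\<^sub>o U) V Y"
    by (simp add: pentagon)
  also have "\<dots> = (\<one> U \<otimes> swap W V Y) \<cdot> (\<alpha> U W (V \<otimes>\<^sub>o Y) \<cdot> \<alpha> (U \<otimes>\<^sub>o W) V Y) \<cdot> ((\<b> W U \<otimes> \<one> V) \<otimes> \<one> Y)"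
    by (simp add: swap_Assoc[THEN Comp_extend] Assoc_nat_left)
  also have "\<dots> = (\<one> U \<otimes> (swap W V Y \<cdot> \<alpha> W V Y)) \<cdot> ?M"
    by (simp add: pentagon[symmetric] del: Comp_assoc') simp
  finally show "(\<alpha> U V (W \<otimes>\<^sub>o Y) \<cdot> swap W (U \<otimes>\<^sub>o V) Y) \<cdot> ?P
    = ((\<one> U \<otimes> swap W V Y) \<cdot> swap W U (V \<otimes>\<^sub>o Y) \<cdot> (\<one> W \<otimes> \<alpha> U V Y)) \<cdot> ?P"
    using L by simp
qed simp_all

lemma Braid_Tensor_left:
  assumes [simp]: "W \<in> Obj C" "V \<in> Obj C" "X \<in> Obj C"
  shows "\<b> (W \<otimes>\<^sub>o V) X
    = \<alpha> X W V \<cdot> (\<b> W X \<otimes> \<one> V) \<cdot> inv (\<alpha> W X V) \<cdot> (\<one> W \<otimes> \<b> V X) \<cdot> \<alpha> W V X"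
proof -
  have "\<b> (W \<otimes>\<^sub>o V) X = \<alpha> X W V \<cdot> (inv (\<alpha> X W V) \<cdot> \<b> (W \<otimes>\<^sub>o V) X \<cdot> inv (\<alpha> W V X)) \<cdot> \<alpha> W V X"
    by simp
  then show ?thesis
    by (simp only: hexagon2[OF assms]) simp
qed

text \<open>The second hexagon, with a spectator \<open>Y\<close> on the right. After precomposing with an
  associator, the braiding of \<open>W \<otimes> V\<close> is expanded into two braidings, which are turned back into
  swaps from left to right; \<open>?Z\<close> is the part not yet treated.\<close>
lemma swap_Tensor_left:
  assumes [simp]: "W \<in> Obj C" "V \<in> Obj C" "X \<in> Obj C" "Y \<in> Obj C"
  shows "(\<one> X \<otimes> \<alpha> W V Y) \<cdot> swap (W \<otimes>\<^sub>o V) X Y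
    = swap W X (V \<otimes>\<^sub>o Y) \<cdot> (\<one> W \<otimes> swap V X Y) \<cdot> \<alpha> W V (X \<otimes>\<^sub>o Y)"
proof (rule iso_cancel_right[of "\<alpha> (W \<otimes>\<^sub>o V) X Y"])
  let ?Z = "inv (\<alpha> W X V) \<cdot> (\<one> W \<otimes> \<b> V X) \<cdot> \<alpha> W V X"
  have "((\<one> X \<otimes> \<alpha> W V Y) \<cdot> swap (W \<otimes>\<^sub>o V) X Y) \<cdot> \<alpha> (W \<otimes>\<^sub>o V) X Y
      = ((\<one> X \<otimes> \<alpha> W V Y) \<cdot> \<alpha> X (W \<otimes>\<^sub>o V) Y \<cdot> (\<alpha> X W V \<otimes> \<one> Y)) \<cdot> ((\<b> W X \<otimes> \<one> V) \<otimes> \<one> Y) \<cdot> (?Z \<otimes> \<one> Y)"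
    by (simp add: swap_Assoc Braid_Tensor_left)
  also have "\<dots> = \<alpha> X W (V \<otimes>\<^sub>o Y) \<cdot> \<alpha> (X \<otimes>\<^sub>o W) V Y \<cdot> ((\<b> W X \<otimes> \<one> V) \<otimes> \<one> Y) \<cdot> (?Z \<otimes> \<one> Y)"
    by (simp only: pentagon[OF assms(3,1,2,4)]) simp
  also have "\<dots> = \<alpha> X W (V \<otimes>\<^sub>o Y) \<cdot> (\<b> W X \<otimes> \<one> (V \<otimes>\<^sub>o Y)) \<cdot> \<alpha> (W \<otimes>\<^sub>o X) V Y \<cdot> (?Z \<otimes> \<one> Y)"
    by (simp add: Assoc_nat_left[THEN Comp_extend] del: interchange interchange_pre)
  also have "\<dots> = swap W X (V \<otimes>\<^sub>o Y) \<cdot> (\<alpha> W X (V \<otimes>\<^sub>o Y) \<cdot> \<alpha> (W \<otimes>\<^sub>o X) V Y) \<cdot> (?Z \<otimes> \<one> Y)"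
    by (simp add: swap_Assoc[THEN Comp_extend])
  also have "\<dots> = swap W X (V \<otimes>\<^sub>o Y) \<cdot> (\<one> W \<otimes> \<alpha> X V Y) \<cdot> \<alpha> W (X \<otimes>\<^sub>o V) Y
    \<cdot> (((\<one> W \<otimes> \<b> V X) \<cdot> \<alpha> W V X) \<otimes> \<one> Y)"
    by (simp only: pentagon[OF assms(1,3,2,4), symmetric]) simp
  also have "\<dots> = swap W X (V \<otimes>\<^sub>o Y) \<cdot> (\<one> W \<otimes> \<alpha> X V Y) \<cdot> \<alpha> W (X \<otimes>\<^sub>o V) Y \<cdot> ((\<one> W \<otimes> \<b> V X) \<otimes> \<one> Y)
    \<cdot> (\<alpha> W V X \<otimes> \<one> Y)"
    by simp
  also have "\<dots> = swap W X (V \<otimes>\<^sub>o Y) \<cdot> (\<one> W \<otimes> (\<alpha> X V Y \<cdot> (\<b> V X \<otimes> \<one> Y))) \<cdot> \<alpha> W (V \<otimes>\<^sub>o X) Y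
    \<cdot> (\<alpha> W V X \<otimes> \<one> Y)"
    by (simp add: Assoc_nat[THEN Comp_extend] del: interchange)
  also have "\<dots> = swap W X (V \<otimes>\<^sub>o Y) \<cdot> (\<one> W \<otimes> swap V X Y)
    \<cdot> ((\<one> W \<otimes> \<alpha> V X Y) \<cdot> \<alpha> W (V \<otimes>\<^sub>o X) Y \<cdot> (\<alpha> W V X \<otimes> \<one> Y))"
    by (simp add: swap_Assoc)
  also have "\<dots> = (swap W X (V \<otimes>\<^sub>o Y) \<cdot> (\<one> W \<otimes> swap V X Y) \<cdot> \<alpha> W V (X \<otimes>\<^sub>o Y)) \<cdot> \<alpha> (W \<otimes>\<^sub>o V) X Y"
    by (simp only: pentagon[OF assms]) simp
  finally show "((\<one> X \<otimes> \<alpha> W V Y) \<cdot> swap (W \<otimes>\<^sub>o V) X Y) \<cdot> \<alpha> (W \<otimes>\<^sub>o V) X Y =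
    (swap W X (V \<otimes>\<^sub>o Y) \<cdot> (\<one> W \<otimes> swap V X Y) \<cdot> \<alpha> W V (X \<otimes>\<^sub>o Y)) \<cdot> \<alpha> (W \<otimes>\<^sub>o V) X Y" .
qed simp_all

text \<open>Tensoring a swap with an object on the right gives a swap again; only pentagons are
  involved.\<close>
lemma swap_Tensor_right:
  assumes [simp]: "W \<in> Obj C" "X \<in> Obj C" "Y \<in> Obj C" "Z \<in> Obj C"
  shows "swap W X (Y \<otimes>\<^sub>o Z) \<cdot> (\<one> W \<otimes> \<alpha> X Y Z) \<cdot> \<alpha> W (X \<otimes>\<^sub>o Y) Z
    = (\<one> X \<otimes> \<alpha> W Y Z) \<cdot> \<alpha> X (W \<otimes>\<^sub>o Y) Z \<cdot> (swap W X Y \<otimes> \<one> Z)"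
proof (rule iso_cancel_right[of "\<alpha> W X Y \<otimes> \<one> Z"])
  have "(swap W X (Y \<otimes>\<^sub>o Z) \<cdot> (\<one> W \<otimes> \<alpha> X Y Z) \<cdot> \<alpha> W (X \<otimes>\<^sub>o Y) Z) \<cdot> (\<alpha> W X Y \<otimes> \<one> Z)
      = swap W X (Y \<otimes>\<^sub>o Z) \<cdot> ((\<one> W \<otimes> \<alpha> X Y Z) \<cdot> \<alpha> W (X \<otimes>\<^sub>o Y) Z \<cdot> (\<alpha> W X Y \<otimes> \<one> Z))"
    by simp
  also have "\<dots> = swap W X (Y \<otimes>\<^sub>o Z) \<cdot> \<alpha> W X (Y \<otimes>\<^sub>o Z) \<cdot> \<alpha> (W \<otimes>\<^sub>o X) Y Z"
    by (simp only: pentagon[OF assms])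
  also have "\<dots> = (\<alpha> X W (Y \<otimes>\<^sub>o Z) \<cdot> \<alpha> (X \<otimes>\<^sub>o W) Y Z) \<cdot> ((\<b> W X \<otimes> \<one> Y) \<otimes> \<one> Z)"
    by (simp add: swap_Assoc[THEN Comp_extend] Assoc_nat_left)
  also have "\<dots> = (\<one> X \<otimes> \<alpha> W Y Z) \<cdot> \<alpha> X (W \<otimes>\<^sub>o Y) Z \<cdot> ((\<alpha> X W Y \<cdot> (\<b> W X \<otimes> \<one> Y)) \<otimes> \<one> Z)"
    by (simp only: pentagon[OF assms(2,1,3,4), symmetric]) simp
  also have "\<dots> = ((\<one> X \<otimes> \<alpha> W Y Z) \<cdot> \<alpha> X (W \<otimes>\<^sub>o Y) Z \<cdot> (swap W X Y \<otimes> \<one> Z)) \<cdot> (\<alpha> W X Y \<otimes> \<one> Z)"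
    by (simp add: swap_Assoc)
  finally show "(swap W X (Y \<otimes>\<^sub>o Z) \<cdot> (\<one> W \<otimes> \<alpha> X Y Z) \<cdot> \<alpha> W (X \<otimes>\<^sub>o Y) Z) \<cdot> (\<alpha> W X Y \<otimes> \<one> Z) = \<dots>" .
qed simp_all

text \<open>Naturality of \<open>swap (W \<otimes>\<^sub>o V) X Y\<close> with respect to \<open>\<b> W V\<close>, both sides being expanded by
  the second hexagon.\<close>
lemma Yang_Baxter:
  assumes [simp]: "W \<in> Obj C" "V \<in> Obj C" "X \<in> Obj C" "Y \<in> Obj C"
  shows "(\<one> X \<otimes> swap W V Y) \<cdot> swap W X (V \<otimes>\<^sub>o Y) \<cdot> (\<one> W \<otimes> swap V X Y)
    = swap V X (W \<otimes>\<^sub>o Y) \<cdot> (\<one> V \<otimes> swap W X Y) \<cdot> swap W V (X \<otimes>\<^sub>o Y)"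
proof (rule iso_cancel_right[of "\<alpha> W V (X \<otimes>\<^sub>o Y)"])
  have "((\<one> X \<otimes> swap W V Y) \<cdot> swap W X (V \<otimes>\<^sub>o Y) \<cdot> (\<one> W \<otimes> swap V X Y)) \<cdot> \<alpha> W V (X \<otimes>\<^sub>o Y)
      = (\<one> X \<otimes> swap W V Y) \<cdot> (\<one> X \<otimes> \<alpha> W V Y) \<cdot> swap (W \<otimes>\<^sub>o V) X Y"
    by (simp only: swap_Tensor_left[OF assms]) simp
  also have "\<dots> = (\<one> X \<otimes> \<alpha> V W Y) \<cdot> (\<one> X \<otimes> (\<b> W V \<otimes> \<one> Y)) \<cdot> swap (W \<otimes>\<^sub>o V) X Y"
    by (simp add: swap_Assoc)
  also have "\<dots> = ((\<one> X \<otimes> \<alpha> V W Y) \<cdot> swap (V \<otimes>\<^sub>o W) X Y) \<cdot> (\<b> W V \<otimes> \<one> (X \<otimes>\<^sub>o Y))"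
    using swap_nat[of "\<b> W V" "\<one> X" "\<one> Y" "V \<otimes>\<^sub>o W" X Y] by simp
  also have "\<dots> = (swap V X (W \<otimes>\<^sub>o Y) \<cdot> (\<one> V \<otimes> swap W X Y) \<cdot> swap W V (X \<otimes>\<^sub>o Y)) \<cdot> \<alpha> W V (X \<otimes>\<^sub>o Y)"
    by (simp add: swap_Tensor_left swap_Assoc)
  finally show "((\<one> X \<otimes> swap W V Y) \<cdot> swap W X (V \<otimes>\<^sub>o Y) \<cdot> (\<one> W \<otimes> swap V X Y)) \<cdot> \<alpha> W V (X \<otimes>\<^sub>o Y)
    = \<dots>" .
qed simp_all

text \<open>The braiding with the unit is the canonical isomorphism. By naturality along \<open>\<rho>\<^sub>r \<I>\<close>,
  moving past \<open>\<I>\<close> is determined by moving past \<open>\<I> \<otimes> \<I>\<close>, which the first hexagon splits into two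
  moves past \<open>\<I>\<close>; cancelling one of them leaves the claim.\<close>
lemma swap_Unit_middle:
  assumes [simp]: "W \<in> Obj C" "Y \<in> Obj C"
  shows "\<lambda>\<^sub>l (W \<otimes>\<^sub>o Y) \<cdot> swap W \<I> Y = \<one> W \<otimes> \<lambda>\<^sub>l Y"
proof (rule unit_tensor_faithful, goal_cases)
  case 5
  have "(\<one> \<I> \<otimes> (\<lambda>\<^sub>l (W \<otimes>\<^sub>o Y) \<cdot> swap W \<I> Y)) \<cdot> (swap W \<I> (\<I> \<otimes>\<^sub>o Y) \<cdot> (\<one> W \<otimes> \<alpha> \<I> \<I> Y))
      = (\<one> \<I> \<otimes> \<lambda>\<^sub>l (W \<otimes>\<^sub>o Y)) \<cdot> \<alpha> \<I> \<I> (W \<otimes>\<^sub>o Y) \<cdot> swap W (\<I> \<otimes>\<^sub>o \<I>) Y"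
    by (simp add: swap_Tensor_middle)
  also have "\<dots> = (\<rho>\<^sub>r \<I> \<otimes> \<one> (W \<otimes>\<^sub>o Y)) \<cdot> swap W (\<I> \<otimes>\<^sub>o \<I>) Y"
    by (simp add: triangle[THEN Comp_extend])
  also have "\<dots> = swap W \<I> Y \<cdot> (\<one> W \<otimes> (\<rho>\<^sub>r \<I> \<otimes> \<one> Y))"
    using swap_nat[of "\<one> W" "\<rho>\<^sub>r \<I>" "\<one> Y" W \<I> Y] by simp
  also have "\<dots> = swap W \<I> Y \<cdot> (\<one> W \<otimes> (\<one> \<I> \<otimes> \<lambda>\<^sub>l Y)) \<cdot> (\<one> W \<otimes> \<alpha> \<I> \<I> Y)"
    by (simp add: triangle)
  also have "\<dots> = (\<one> \<I> \<otimes> (\<one> W \<otimes> \<lambda>\<^sub>l Y)) \<cdot> (swap W \<I> (\<I> \<otimes>\<^sub>o Y) \<cdot> (\<one> W \<otimes> \<alpha> \<I> \<I> Y))"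
    using swap_nat[of "\<one> W" "\<one> \<I>" "\<lambda>\<^sub>l Y" W \<I> Y, THEN Comp_extend, of "\<one> W \<otimes> \<alpha> \<I> \<I> Y"] by simp
  finally show ?case
    by (rule iso_cancel_right[rotated 5]) simp_all
qed simp_all

text \<open>The same argument with the second hexagon: \<open>\<I> \<otimes> \<I>\<close> moving past \<open>X\<close> amounts to two moves of
  \<open>\<I>\<close>.\<close>
lemma swap_Unit_left:
  assumes [simp]: "X \<in> Obj C" "Y \<in> Obj C"
  shows "(\<one> X \<otimes> \<lambda>\<^sub>l Y) \<cdot> swap \<I> X Y = \<lambda>\<^sub>l (X \<otimes>\<^sub>o Y)"
proof (rule unit_tensor_faithful, goal_cases)
  case 5
  have "\<one> \<I> \<otimes> ((\<one> X \<otimes> \<lambda>\<^sub>l Y) \<cdot> swap \<I> X Y) = \<one> \<I> \<otimes> \<lambda>\<^sub>l (X \<otimes>\<^sub>o Y)"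
  proof (rule iso_cancel_left[of "swap \<I> X Y"], goal_cases)
    case 6
    have "(swap \<I> X Y \<cdot> (\<one> \<I> \<otimes> ((\<one> X \<otimes> \<lambda>\<^sub>l Y) \<cdot> swap \<I> X Y))) \<cdot> \<alpha> \<I> \<I> (X \<otimes>\<^sub>o Y)
      = (swap \<I> X Y \<cdot> (\<one> \<I> \<otimes> (\<one> X \<otimes> \<lambda>\<^sub>l Y))) \<cdot> (\<one> \<I> \<otimes> swap \<I> X Y) \<cdot> \<alpha> \<I> \<I> (X \<otimes>\<^sub>o Y)"
      by simp
    also have "\<dots> = (\<one> X \<otimes> (\<one> \<I> \<otimes> \<lambda>\<^sub>l Y)) \<cdot> (swap \<I> X (\<I> \<otimes>\<^sub>o Y) \<cdot> (\<one> \<I> \<otimes> swap \<I> X Y)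
      \<cdot> \<alpha> \<I> \<I> (X \<otimes>\<^sub>o Y))"
      using swap_nat[of "\<one> \<I>" "\<one> X" "\<lambda>\<^sub>l Y" \<I> X Y] by simp
    also have "\<dots> = (\<one> X \<otimes> (\<rho>\<^sub>r \<I> \<otimes> \<one> Y)) \<cdot> swap (\<I> \<otimes>\<^sub>o \<I>) X Y"
      by (simp add: swap_Tensor_left[symmetric] triangle)
    also have "\<dots> = swap \<I> X Y \<cdot> (\<rho>\<^sub>r \<I> \<otimes> \<one> (X \<otimes>\<^sub>o Y))"
      using swap_nat[of "\<rho>\<^sub>r \<I>" "\<one> X" "\<one> Y" \<I> X Y] by simp
    also have "\<dots> = (swap \<I> X Y \<cdot> (\<one> \<I> \<otimes> \<lambda>\<^sub>l (X \<otimes>\<^sub>o Y))) \<cdot> \<alpha> \<I> \<I> (X \<otimes>\<^sub>o Y)"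
      by (simp add: triangle)
    finally show ?case
      by (rule iso_cancel_right[rotated 5]) simp_all
  qed simp_all
  then show ?case .
qed simp_all

end

section \<open>Extending endomorphisms of a tensor product by a spectator\<close>

context braided_monoidal_category
begin

text \<open>Endomorphisms of \<open>A \<otimes> Q\<close> are extended to \<open>A \<otimes> (Q \<otimes> X)\<close> and to \<open>A \<otimes> (X \<otimes> Q)\<close>. In the latter
  case \<open>A\<close> first moves past \<open>X\<close> and finally returns by the inverse braiding; with \<open>A\<close> in place
  of \<open>X\<close> this is the factor on the first and third positions of the fusion equation.\<close>
definition whisker_right where
  "whisker_right A Q X q = \<alpha> A Q X \<cdot> (q \<otimes> \<one> X) \<cdot> inv (\<alpha> A Q X)"

definition whisker_left where
  "whisker_left A X Q q = inv (swap A X Q) \<cdot> (\<one> X \<otimes> q) \<cdot> swap A X Q"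

lemma whisker_simps [simp]:
  assumes "A \<in> Obj C" "Q \<in> Obj C" "X \<in> Obj C" "q \<in> Arr C" "Dom C q = A \<otimes>\<^sub>o Q" "Cod C q = A \<otimes>\<^sub>o Q"
  shows "whisker_right A Q X q \<in> Arr C" "Dom C (whisker_right A Q X q) = A \<otimes>\<^sub>o (Q \<otimes>\<^sub>o X)"
    "Cod C (whisker_right A Q X q) = A \<otimes>\<^sub>o (Q \<otimes>\<^sub>o X)"
    "whisker_left A X Q q \<in> Arr C" "Dom C (whisker_left A X Q q) = A \<otimes>\<^sub>o (X \<otimes>\<^sub>o Q)"
    "Cod C (whisker_left A X Q q) = A \<otimes>\<^sub>o (X \<otimes>\<^sub>o Q)"
  using assms by (simp_all add: whisker_left_def whisker_right_def)

lemma whisker_right_Assoc: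
  assumes "A \<in> Obj C" "Q \<in> Obj C" "X \<in> Obj C" "q \<in> Hom C (A \<otimes>\<^sub>o Q) (A \<otimes>\<^sub>o Q)"
  shows "whisker_right A Q X q \<cdot> \<alpha> A Q X = \<alpha> A Q X \<cdot> (q \<otimes> \<one> X)"
  using assms by (simp add: whisker_right_def)

lemma swap_whisker_left:
  assumes "A \<in> Obj C" "Q \<in> Obj C" "X \<in> Obj C" "q \<in> Hom C (A \<otimes>\<^sub>o Q) (A \<otimes>\<^sub>o Q)"
  shows "swap A X Q \<cdot> whisker_left A X Q q = (\<one> X \<otimes> q) \<cdot> swap A X Q"
  using assms by (simp add: whisker_left_def)

lemma whisker_right_Comp:
  assumes "A \<in> Obj C" "Q \<in> Obj C" "X \<in> Obj C" "q \<in> Hom C (A \<otimes>\<^sub>o Q) (A \<otimes>\<^sub>o Q)"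
    "r \<in> Hom C (A \<otimes>\<^sub>o Q) (A \<otimes>\<^sub>o Q)"
  shows "whisker_right A Q X (q \<cdot> r) = whisker_right A Q X q \<cdot> whisker_right A Q X r"
  using assms by (simp add: whisker_right_def)

lemma whisker_left_Comp:
  assumes "A \<in> Obj C" "Q \<in> Obj C" "X \<in> Obj C" "q \<in> Hom C (A \<otimes>\<^sub>o Q) (A \<otimes>\<^sub>o Q)"
    "r \<in> Hom C (A \<otimes>\<^sub>o Q) (A \<otimes>\<^sub>o Q)"
  shows "whisker_left A X Q (q \<cdot> r) = whisker_left A X Q q \<cdot> whisker_left A X Q r"
  using assms by (simp add: whisker_left_def)

lemma whisker_right_Id:
  assumes "A \<in> Obj C" "Q \<in> Obj C" "X \<in> Obj C"
  shows "whisker_right A Q X (\<one> (A \<otimes>\<^sub>o Q)) = \<one> (A \<otimes>\<^sub>o (Q \<otimes>\<^sub>o X))"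
  using assms by (simp add: whisker_right_def)

lemma whisker_left_Id:
  assumes "A \<in> Obj C" "Q \<in> Obj C" "X \<in> Obj C"
  shows "whisker_left A X Q (\<one> (A \<otimes>\<^sub>o Q)) = \<one> (A \<otimes>\<^sub>o (X \<otimes>\<^sub>o Q))"
  using assms by (simp add: whisker_left_def)

lemma whisker_right_nat:
  assumes [simp]: "A \<in> Obj C" "f \<in> Hom C Q Q'" "g \<in> Hom C X X'" "Q \<in> Obj C" "X \<in> Obj C"
    "Q' \<in> Obj C" "X' \<in> Obj C"
    "q \<in> Hom C (A \<otimes>\<^sub>o Q) (A \<otimes>\<^sub>o Q)" "q' \<in> Hom C (A \<otimes>\<^sub>o Q') (A \<otimes>\<^sub>o Q')"
    and eq: "(\<one> A \<otimes> f) \<cdot> q = q' \<cdot> (\<one> A \<otimes> f)"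
  shows "(\<one> A \<otimes> (f \<otimes> g)) \<cdot> whisker_right A Q X q = whisker_right A Q' X' q' \<cdot> (\<one> A \<otimes> (f \<otimes> g))"
proof (rule iso_cancel_right[of "\<alpha> A Q X"], goal_cases)
  case 6
  have [simp]: "f \<in> Arr C" "Dom C f = Q" "Cod C f = Q'" "g \<in> Arr C" "Dom C g = X" "Cod C g = X'"
    "q \<in> Arr C" "Dom C q = A \<otimes>\<^sub>o Q" "Cod C q = A \<otimes>\<^sub>o Q"
    "q' \<in> Arr C" "Dom C q' = A \<otimes>\<^sub>o Q'" "Cod C q' = A \<otimes>\<^sub>o Q'" using assms by auto
  have "((\<one> A \<otimes> (f \<otimes> g)) \<cdot> whisker_right A Q X q) \<cdot> \<alpha> A Q X
      = ((\<one> A \<otimes> (f \<otimes> g)) \<cdot> \<alpha> A Q X) \<cdot> (q \<otimes> \<one> X)"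
    by (simp add: whisker_right_Assoc)
  also have "\<dots> = \<alpha> A Q' X' \<cdot> (((\<one> A \<otimes> f) \<cdot> q) \<otimes> g)"
    using Assoc_nat[of "\<one> A" f g A Q' X', symmetric, THEN Comp_extend, of "q \<otimes> \<one> X"] by simp
  also have "\<dots> = \<alpha> A Q' X' \<cdot> (q' \<otimes> \<one> X') \<cdot> ((\<one> A \<otimes> f) \<otimes> g)"
    by (simp add: eq)
  also have "\<dots> = whisker_right A Q' X' q' \<cdot> \<alpha> A Q' X' \<cdot> ((\<one> A \<otimes> f) \<otimes> g)"
    by (simp add: whisker_right_Assoc[THEN Comp_extend])
  also have "\<dots> = (whisker_right A Q' X' q' \<cdot> (\<one> A \<otimes> (f \<otimes> g))) \<cdot> \<alpha> A Q X"
    by (simp add: Assoc_nat)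
  finally show ?case .
qed (use assms in simp_all)

lemma whisker_left_nat:
  assumes "A \<in> Obj C" "f \<in> Hom C Q Q'" "g \<in> Hom C X X'" "Q \<in> Obj C" "X \<in> Obj C" "Q' \<in> Obj C"
    "X' \<in> Obj C"
    "q \<in> Hom C (A \<otimes>\<^sub>o Q) (A \<otimes>\<^sub>o Q)" "q' \<in> Hom C (A \<otimes>\<^sub>o Q') (A \<otimes>\<^sub>o Q')"
    and eq: "(\<one> A \<otimes> f) \<cdot> q = q' \<cdot> (\<one> A \<otimes> f)"
  shows "(\<one> A \<otimes> (g \<otimes> f)) \<cdot> whisker_left A X Q q = whisker_left A X' Q' q' \<cdot> (\<one> A \<otimes> (g \<otimes> f))"
proof (rule iso_cancel_left[of "swap A X' Q'"], goal_cases)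
  case 6
  have [simp]: "A \<in> Obj C" "Q \<in> Obj C" "X \<in> Obj C" "Q' \<in> Obj C" "X' \<in> Obj C"
    "f \<in> Arr C" "Dom C f = Q" "Cod C f = Q'" "g \<in> Arr C" "Dom C g = X" "Cod C g = X'"
    "q \<in> Arr C" "Dom C q = A \<otimes>\<^sub>o Q" "Cod C q = A \<otimes>\<^sub>o Q"
    "q' \<in> Arr C" "Dom C q' = A \<otimes>\<^sub>o Q'" "Cod C q' = A \<otimes>\<^sub>o Q'" using assms by auto
  have n: "swap A X' Q' \<cdot> (\<one> A \<otimes> (g \<otimes> f)) = (g \<otimes> (\<one> A \<otimes> f)) \<cdot> swap A X Q"
    using swap_nat[of "\<one> A" g f A X' Q'] by simp
  have "swap A X' Q' \<cdot> (\<one> A \<otimes> (g \<otimes> f)) \<cdot> whisker_left A X Q q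
      = (g \<otimes> ((\<one> A \<otimes> f) \<cdot> q)) \<cdot> swap A X Q"
    by (simp add: n[THEN Comp_extend] swap_whisker_left)
  also have "\<dots> = (\<one> X' \<otimes> q') \<cdot> (g \<otimes> (\<one> A \<otimes> f)) \<cdot> swap A X Q"
    by (simp add: eq)
  also have "\<dots> = swap A X' Q' \<cdot> whisker_left A X' Q' q' \<cdot> (\<one> A \<otimes> (g \<otimes> f))"
    by (simp only: n[symmetric]) (simp add: swap_whisker_left[THEN Comp_extend])
  finally show ?case .
qed (use assms in simp_all)

text \<open>Whiskering by \<open>R\<close> and then by \<open>S\<close> agrees with whiskering by \<open>R \<otimes> S\<close>, by the pentagon. For
  the fusion morphism \<open>t\<close> in place of \<open>q\<close> this compares \<open>t\<close> acting on \<open>A \<otimes> (A \<otimes> (R \<otimes> S))\<close> with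
  \<open>t\<close> acting on \<open>(A \<otimes> (A \<otimes> R)) \<otimes> S\<close>.\<close>
lemma whisker_right_Tensor:
  assumes [simp]: "A \<in> Obj C" "Q \<in> Obj C" "R \<in> Obj C" "S \<in> Obj C"
    and q: "q \<in> Hom C (A \<otimes>\<^sub>o Q) (A \<otimes>\<^sub>o Q)"
  shows "whisker_right A Q (R \<otimes>\<^sub>o S) q \<cdot> (\<one> A \<otimes> \<alpha> Q R S) \<cdot> \<alpha> A (Q \<otimes>\<^sub>o R) S
    = (\<one> A \<otimes> \<alpha> Q R S) \<cdot> \<alpha> A (Q \<otimes>\<^sub>o R) S \<cdot> (whisker_right A Q R q \<otimes> \<one> S)" (is "?l = ?r")
proof (rule iso_cancel_right[of "\<alpha> A Q R \<otimes> \<one> S"])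
  have [simp]: "q \<in> Arr C" "Dom C q = A \<otimes>\<^sub>o Q" "Cod C q = A \<otimes>\<^sub>o Q" using q by auto
  have "?l \<cdot> (\<alpha> A Q R \<otimes> \<one> S) = whisker_right A Q (R \<otimes>\<^sub>o S) q
    \<cdot> ((\<one> A \<otimes> \<alpha> Q R S) \<cdot> \<alpha> A (Q \<otimes>\<^sub>o R) S \<cdot> (\<alpha> A Q R \<otimes> \<one> S))"
    by simp
  also have "\<dots> = whisker_right A Q (R \<otimes>\<^sub>o S) q \<cdot> \<alpha> A Q (R \<otimes>\<^sub>o S) \<cdot> \<alpha> (A \<otimes>\<^sub>o Q) R S"
    by (simp only: pentagon[OF assms(1-4)])
  also have "\<dots> = (\<alpha> A Q (R \<otimes>\<^sub>o S) \<cdot> \<alpha> (A \<otimes>\<^sub>o Q) R S) \<cdot> ((q \<otimes> \<one> R) \<otimes> \<one> S)"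
    by (simp add: whisker_right_Assoc[THEN Comp_extend] Assoc_nat_left)
  also have "\<dots> = (\<one> A \<otimes> \<alpha> Q R S) \<cdot> \<alpha> A (Q \<otimes>\<^sub>o R) S \<cdot> ((\<alpha> A Q R \<cdot> (q \<otimes> \<one> R)) \<otimes> \<one> S)"
    by (simp only: pentagon[OF assms(1-4), symmetric]) simp
  also have "\<dots> = ?r \<cdot> (\<alpha> A Q R \<otimes> \<one> S)"
    by (simp add: whisker_right_Assoc)
  finally show "?l \<cdot> (\<alpha> A Q R \<otimes> \<one> S) = ?r \<cdot> (\<alpha> A Q R \<otimes> \<one> S)" .
qed (use q in simp_all)

lemma whisker_right_right:
  assumes [simp]: "A \<in> Obj C" "Q \<in> Obj C" "R \<in> Obj C" "S \<in> Obj C"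
    and q: "q \<in> Hom C (A \<otimes>\<^sub>o Q) (A \<otimes>\<^sub>o Q)"
  shows "(\<one> A \<otimes> \<alpha> Q R S) \<cdot> whisker_right A (Q \<otimes>\<^sub>o R) S (whisker_right A Q R q)
    = whisker_right A Q (R \<otimes>\<^sub>o S) q \<cdot> (\<one> A \<otimes> \<alpha> Q R S)"
proof (rule iso_cancel_right[of "\<alpha> A (Q \<otimes>\<^sub>o R) S"], goal_cases)
  case 6
  have [simp]: "q \<in> Arr C" "Dom C q = A \<otimes>\<^sub>o Q" "Cod C q = A \<otimes>\<^sub>o Q" using q by auto
  show ?case by (simp add: whisker_right_Tensor whisker_right_Assoc)
qed (use q in simp_all)

lemma whisker_right_left:
  assumes [simp]: "A \<in> Obj C" "Q \<in> Obj C" "R \<in> Obj C" "S \<in> Obj C"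
    and r: "r \<in> Hom C (A \<otimes>\<^sub>o R) (A \<otimes>\<^sub>o R)"
  shows "(\<one> A \<otimes> \<alpha> Q R S) \<cdot> whisker_right A (Q \<otimes>\<^sub>o R) S (whisker_left A Q R r)
    = whisker_left A Q (R \<otimes>\<^sub>o S) (whisker_right A R S r) \<cdot> (\<one> A \<otimes> \<alpha> Q R S)" (is "?l = ?r")
proof (rule iso_cancel_right[of "\<alpha> A (Q \<otimes>\<^sub>o R) S"])
  have [simp]: "r \<in> Arr C" "Dom C r = A \<otimes>\<^sub>o R" "Cod C r = A \<otimes>\<^sub>o R" using r by auto
  show "?l \<cdot> \<alpha> A (Q \<otimes>\<^sub>o R) S = ?r \<cdot> \<alpha> A (Q \<otimes>\<^sub>o R) S"
  proof (rule iso_cancel_left[of "swap A Q (R \<otimes>\<^sub>o S)"])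
    have "swap A Q (R \<otimes>\<^sub>o S) \<cdot> (?l \<cdot> \<alpha> A (Q \<otimes>\<^sub>o R) S)
        = (swap A Q (R \<otimes>\<^sub>o S) \<cdot> (\<one> A \<otimes> \<alpha> Q R S) \<cdot> \<alpha> A (Q \<otimes>\<^sub>o R) S) \<cdot> (whisker_left A Q R r \<otimes> \<one> S)"
      by (simp add: whisker_right_Assoc)
    also have "\<dots> = (\<one> Q \<otimes> \<alpha> A R S) \<cdot> \<alpha> Q (A \<otimes>\<^sub>o R) S \<cdot> ((swap A Q R \<cdot> whisker_left A Q R r) \<otimes> \<one> S)"
      by (simp only: swap_Tensor_right[OF assms(1-4)]) simp
    also have "\<dots> = (\<one> Q \<otimes> \<alpha> A R S) \<cdot> \<alpha> Q (A \<otimes>\<^sub>o R) S \<cdot> ((\<one> Q \<otimes> r) \<otimes> \<one> S) \<cdot> (swap A Q R \<otimes> \<one> S)"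
      by (simp add: swap_whisker_left)
    also have "\<dots> = (\<one> Q \<otimes> (\<alpha> A R S \<cdot> (r \<otimes> \<one> S))) \<cdot> \<alpha> Q (A \<otimes>\<^sub>o R) S \<cdot> (swap A Q R \<otimes> \<one> S)"
      by (simp add: Assoc_nat[THEN Comp_extend] del: interchange)
    also have "\<dots> = (\<one> Q \<otimes> whisker_right A R S r) \<cdot> ((\<one> Q \<otimes> \<alpha> A R S) \<cdot> \<alpha> Q (A \<otimes>\<^sub>o R) S
      \<cdot> (swap A Q R \<otimes> \<one> S))"
      by (simp add: whisker_right_Assoc)
    also have "\<dots> = swap A Q (R \<otimes>\<^sub>o S) \<cdot> (?r \<cdot> \<alpha> A (Q \<otimes>\<^sub>o R) S)"
      by (simp only: swap_Tensor_right[OF assms(1-4), symmetric]) (simp add: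
        swap_whisker_left[THEN Comp_extend])
    finally show "swap A Q (R \<otimes>\<^sub>o S) \<cdot> (?l \<cdot> \<alpha> A (Q \<otimes>\<^sub>o R) S) = swap A Q (R \<otimes>\<^sub>o S)
      \<cdot> (?r \<cdot> \<alpha> A (Q \<otimes>\<^sub>o R) S)" .
  qed simp_all
qed (use r in simp_all)

text \<open>By the first hexagon, moving \<open>A\<close> past \<open>Q \<otimes> R\<close> means moving it past \<open>Q\<close> and then past \<open>R\<close>.\<close>
lemma whisker_left_left:
  assumes [simp]: "A \<in> Obj C" "Q \<in> Obj C" "R \<in> Obj C" "S \<in> Obj C"
    and s: "s \<in> Hom C (A \<otimes>\<^sub>o S) (A \<otimes>\<^sub>o S)"
  shows "(\<one> A \<otimes> \<alpha> Q R S) \<cdot> whisker_left A (Q \<otimes>\<^sub>o R) S s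
    = whisker_left A Q (R \<otimes>\<^sub>o S) (whisker_left A R S s) \<cdot> (\<one> A \<otimes> \<alpha> Q R S)" (is "?l = ?r")
proof (rule iso_cancel_left[of "(\<one> Q \<otimes> swap A R S) \<cdot> swap A Q (R \<otimes>\<^sub>o S)"])
  have [simp]: "s \<in> Arr C" "Dom C s = A \<otimes>\<^sub>o S" "Cod C s = A \<otimes>\<^sub>o S" using s by auto
  let ?k = "(\<one> Q \<otimes> swap A R S) \<cdot> swap A Q (R \<otimes>\<^sub>o S)"
  have "?k \<cdot> ?l = ((\<one> Q \<otimes> swap A R S) \<cdot> swap A Q (R \<otimes>\<^sub>o S) \<cdot> (\<one> A \<otimes> \<alpha> Q R S))
    \<cdot> whisker_left A (Q \<otimes>\<^sub>o R) S s"
    by simp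
  also have "\<dots> = \<alpha> Q R (A \<otimes>\<^sub>o S) \<cdot> (\<one> (Q \<otimes>\<^sub>o R) \<otimes> s) \<cdot> swap A (Q \<otimes>\<^sub>o R) S"
    by (simp only: swap_Tensor_middle[OF assms(1-4), symmetric]) (simp add: swap_whisker_left)
  also have "\<dots> = (\<one> Q \<otimes> (\<one> R \<otimes> s)) \<cdot> \<alpha> Q R (A \<otimes>\<^sub>o S) \<cdot> swap A (Q \<otimes>\<^sub>o R) S"
    by (simp add: Assoc_nat_right[THEN Comp_extend])
  also have "\<dots> = (\<one> Q \<otimes> ((\<one> R \<otimes> s) \<cdot> swap A R S)) \<cdot> swap A Q (R \<otimes>\<^sub>o S) \<cdot> (\<one> A \<otimes> \<alpha> Q R S)"
    by (simp add: swap_Tensor_middle)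
  also have "\<dots> = (\<one> Q \<otimes> (swap A R S \<cdot> whisker_left A R S s)) \<cdot> swap A Q (R \<otimes>\<^sub>o S) \<cdot> (\<one> A \<otimes> \<alpha> Q R S)"
    by (simp add: swap_whisker_left)
  also have "\<dots> = ?k \<cdot> ?r"
    by (simp add: swap_whisker_left[of A "R \<otimes>\<^sub>o S" Q, THEN Comp_extend])
  finally show "?k \<cdot> ?l = ?k \<cdot> ?r" .
qed (use s in simp_all)

end

section \<open>The fusion equation\<close>

locale counital_fusion = braided_monoidal_category C
  for C :: "('o, 'm, 'x) braided_monoidal_category_scheme" (structure) +
  fixes A :: 'o and t e :: 'm
  assumes fusion: "counital_fusion_morphism C A t e"
begin

lemma A_t_e_simps [simp]:
  "A \<in> Obj C" "t \<in> Arr C" "Dom C t = A \<otimes>\<^sub>o A" "Cod C t = A \<otimes>\<^sub>o A"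
  "e \<in> Arr C" "Dom C e = A" "Cod C e = \<I>"
  using fusion by (auto simp: counital_fusion_morphism_def)

lemma counit_t: "(\<one> A \<otimes> e) \<cdot> t = \<one> A \<otimes> e"
  using fusion by (auto simp: counital_fusion_morphism_def)

abbreviation T where "T X \<equiv> whisker_right A A X t"
abbreviation \<epsilon> where "\<epsilon> X \<equiv> counit_left C e X"

text \<open>The fusion equation transported from \<open>(A \<otimes> A) \<otimes> Q\<close> to \<open>A \<otimes> (A \<otimes> Q)\<close>: the three factors on
  the left act on positions 1 and 2, 1 and 3, 2 and 3.\<close>
definition fusion_law where
  "fusion_law Q q \<longleftrightarrow> T Q \<cdot> whisker_left A A Q q \<cdot> (\<one> A \<otimes> q) = (\<one> A \<otimes> q) \<cdot> T Q"

lemma fusion_law_iff: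
  assumes [simp]: "Q \<in> Obj C" and q: "q \<in> Hom C (A \<otimes>\<^sub>o Q) (A \<otimes>\<^sub>o Q)"
  shows "fusion_equation C A t Q q \<longleftrightarrow> fusion_law Q q"
proof -
  have [simp]: "q \<in> Arr C" "Dom C q = A \<otimes>\<^sub>o Q" "Cod C q = A \<otimes>\<^sub>o Q" using q by auto
  let ?a = "\<alpha> A A Q" and ?b = "\<b> A A" and ?i = "\<one> Q"
  let ?q = "on_last_two C A A Q q"
  have [simp]: "?q \<in> Arr C" "Dom C ?q = (A \<otimes>\<^sub>o A) \<otimes>\<^sub>o Q" "Cod C ?q = (A \<otimes>\<^sub>o A) \<otimes>\<^sub>o Q"
    by (simp_all add: on_last_two_def)
  let ?l = "(t \<otimes> ?i) \<cdot> (inv ?b \<otimes> ?i) \<cdot> ?q \<cdot> (?b \<otimes> ?i) \<cdot> ?q" and ?r = "?q \<cdot> (t \<otimes> ?i)"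
  have i: "inv (swap A A Q) = ?a \<cdot> (inv ?b \<otimes> ?i) \<cdot> inv ?a"
    by (rule isoI(2)) (simp_all add: swap_def)
  have l: "?a \<cdot> ?l \<cdot> inv ?a = T Q \<cdot> whisker_left A A Q q \<cdot> (\<one> A \<otimes> q)"
    unfolding whisker_left_def i by (simp add: whisker_right_def on_last_two_def swap_def del:
      interchange interchange_pre)
  have r: "?a \<cdot> ?r \<cdot> inv ?a = (\<one> A \<otimes> q) \<cdot> T Q"
    by (simp add: whisker_right_def on_last_two_def del: interchange)
  have "?l = ?r \<longleftrightarrow> ?a \<cdot> ?l \<cdot> inv ?a = ?a \<cdot> ?r \<cdot> inv ?a"
  proof
    assume "?a \<cdot> ?l \<cdot> inv ?a = ?a \<cdot> ?r \<cdot> inv ?a"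
    then have "?l \<cdot> inv ?a = ?r \<cdot> inv ?a"
      by (rule iso_cancel_left[rotated 5]) simp_all
    then show "?l = ?r"
      by (rule iso_cancel_right[rotated 5]) simp_all
  qed simp
  then show ?thesis
    unfolding fusion_law_def fusion_equation_def Let_def l r .
qed

text \<open>The fusion equation is built from \<open>\<one> A \<otimes> x\<close>, the swap and \<open>T X\<close> by composition and
  inversion. Hence it may be checked after replacing these three by isomorphic copies. In the
  two applications the copies are the data for a smaller object, tensored with the identity of
  an object on the right or on the left.\<close>
lemma fusion_law_transport:
  assumes \<phi>: "is_iso C \<phi>" "Dom C \<phi> = A \<otimes>\<^sub>o (A \<otimes>\<^sub>o X)"
    and [simp]: "X \<in> Obj C" "x \<in> Arr C" "Dom C x = A \<otimes>\<^sub>o X" "Cod C x = A \<otimes>\<^sub>o X"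
    and T': "T' \<in> Arr C" "Dom C T' = Cod C \<phi>" "Cod C T' = Cod C \<phi>" "\<phi> \<cdot> T X = T' \<cdot> \<phi>"
    and s': "is_iso C s'" "Dom C s' = Cod C \<phi>" "Cod C s' = Cod C \<phi>" "\<phi> \<cdot> swap A A X = s' \<cdot> \<phi>"
    and x': "x' \<in> Arr C" "Dom C x' = Cod C \<phi>" "Cod C x' = Cod C \<phi>" "\<phi> \<cdot> (\<one> A \<otimes> x) = x' \<cdot> \<phi>"
    and law: "T' \<cdot> inv s' \<cdot> x' \<cdot> s' \<cdot> x' = x' \<cdot> T'"
  shows "fusion_law X x"
proof -
  note [simp] = \<phi> iso_Arr[OF \<phi>(1)] T'(1-3) s'(1-3) iso_Arr[OF s'(1)] x'(1-3)
  have i: "\<phi> \<cdot> inv (swap A A X) = inv s' \<cdot> \<phi>"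
    by (rule intertwine_Inv[symmetric]) (simp_all add: s'(4))
  have "\<phi> \<cdot> (T X \<cdot> whisker_left A A X x \<cdot> (\<one> A \<otimes> x)) = (T' \<cdot> inv s' \<cdot> x' \<cdot> s' \<cdot> x') \<cdot> \<phi>"
    by (simp add: whisker_left_def T'(4)[THEN Comp_extend] i[THEN Comp_extend]
        s'(4)[THEN Comp_extend] x'(4)[THEN Comp_extend] x'(4)
        del: interchange interchange_pre)
  also have "\<dots> = \<phi> \<cdot> ((\<one> A \<otimes> x) \<cdot> T X)"
    unfolding law by (simp add: x'(4)[THEN Comp_extend] T'(4))
  finally show ?thesis
    unfolding fusion_law_def by (rule iso_cancel_left[rotated 5]) simp_all
qed

text \<open>Here \<open>?\<psi>\<close> regroups \<open>(A \<otimes> (A \<otimes> Q)) \<otimes> R\<close> as \<open>A \<otimes> (A \<otimes> (Q \<otimes> R))\<close>; it turns the data for \<open>Q\<close>,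
  tensored with \<open>R\<close>, into the data for \<open>Q \<otimes> R\<close>.\<close>
lemma fusion_law_whisker_right:
  assumes [simp]: "Q \<in> Obj C" "R \<in> Obj C" and q: "q \<in> Hom C (A \<otimes>\<^sub>o Q) (A \<otimes>\<^sub>o Q)"
    and law: "fusion_law Q q"
  shows "fusion_law (Q \<otimes>\<^sub>o R) (whisker_right A Q R q)"
proof -
  have [simp]: "q \<in> Arr C" "Dom C q = A \<otimes>\<^sub>o Q" "Cod C q = A \<otimes>\<^sub>o Q" using q by auto
  let ?\<psi> = "(\<one> A \<otimes> \<alpha> A Q R) \<cdot> \<alpha> A (A \<otimes>\<^sub>o Q) R"
  have 1: "?\<psi> \<cdot> (T Q \<otimes> \<one> R) = T (Q \<otimes>\<^sub>o R) \<cdot> ?\<psi>"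
    by (simp add: whisker_right_Tensor)
  have 2: "?\<psi> \<cdot> (swap A A Q \<otimes> \<one> R) = swap A A (Q \<otimes>\<^sub>o R) \<cdot> ?\<psi>"
    by (simp add: swap_Tensor_right)
  have 3: "?\<psi> \<cdot> ((\<one> A \<otimes> q) \<otimes> \<one> R) = (\<one> A \<otimes> whisker_right A Q R q) \<cdot> ?\<psi>"
    by (simp add: Assoc_nat whisker_right_Assoc)
  show ?thesis
  proof (rule fusion_law_transport[of "inv ?\<psi>"])
    show "inv ?\<psi> \<cdot> T (Q \<otimes>\<^sub>o R) = (T Q \<otimes> \<one> R) \<cdot> inv ?\<psi>"
      by (rule intertwine_Inv[OF _ _ _ _ _ _ _ _ 1]) simp_all
    show "inv ?\<psi> \<cdot> swap A A (Q \<otimes>\<^sub>o R) = (swap A A Q \<otimes> \<one> R) \<cdot> inv ?\<psi>"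
      by (rule intertwine_Inv[OF _ _ _ _ _ _ _ _ 2]) simp_all
    show "inv ?\<psi> \<cdot> (\<one> A \<otimes> whisker_right A Q R q) = ((\<one> A \<otimes> q) \<otimes> \<one> R) \<cdot> inv ?\<psi>"
      by (rule intertwine_Inv[OF _ _ _ _ _ _ _ _ 3]) simp_all
    show "(T Q \<otimes> \<one> R) \<cdot> inv (swap A A Q \<otimes> \<one> R) \<cdot> ((\<one> A \<otimes> q) \<otimes> \<one> R) \<cdot> (swap A A Q \<otimes> \<one> R)
      \<cdot> ((\<one> A \<otimes> q) \<otimes> \<one> R)
      = ((\<one> A \<otimes> q) \<otimes> \<one> R) \<cdot> (T Q \<otimes> \<one> R)"
      using law by (simp add: fusion_law_def whisker_left_def)
  qed simp_all
qed

text \<open>Here \<open>?\<theta>\<close> moves both copies of \<open>A\<close> past \<open>Q\<close>. It is compatible with \<open>t\<close> by the second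
  hexagon, with the swap by the Yang-Baxter equation, and with \<open>r\<close> by naturality.\<close>
lemma fusion_law_whisker_left:
  assumes [simp]: "Q \<in> Obj C" "R \<in> Obj C" and r: "r \<in> Hom C (A \<otimes>\<^sub>o R) (A \<otimes>\<^sub>o R)"
    and law: "fusion_law R r"
  shows "fusion_law (Q \<otimes>\<^sub>o R) (whisker_left A Q R r)"
proof -
  have [simp]: "r \<in> Arr C" "Dom C r = A \<otimes>\<^sub>o R" "Cod C r = A \<otimes>\<^sub>o R" using r by auto
  let ?\<theta> = "swap A Q (A \<otimes>\<^sub>o R) \<cdot> (\<one> A \<otimes> swap A Q R)"
  show ?thesis
  proof (rule fusion_law_transport[of ?\<theta>])
    show "?\<theta> \<cdot> T (Q \<otimes>\<^sub>o R) = (\<one> Q \<otimes> T R) \<cdot> ?\<theta>"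
    proof (rule iso_cancel_right[of "\<alpha> A A (Q \<otimes>\<^sub>o R)"])
      have "(?\<theta> \<cdot> T (Q \<otimes>\<^sub>o R)) \<cdot> \<alpha> A A (Q \<otimes>\<^sub>o R)
          = (swap A Q (A \<otimes>\<^sub>o R) \<cdot> (\<one> A \<otimes> swap A Q R) \<cdot> \<alpha> A A (Q \<otimes>\<^sub>o R)) \<cdot> (t \<otimes> \<one> (Q \<otimes>\<^sub>o R))"
        by (simp add: whisker_right_Assoc)
      also have "\<dots> = (\<one> Q \<otimes> \<alpha> A A R) \<cdot> swap (A \<otimes>\<^sub>o A) Q R \<cdot> (t \<otimes> \<one> (Q \<otimes>\<^sub>o R))"
        by (simp add: swap_Tensor_left[symmetric])
      also have "\<dots> = (\<one> Q \<otimes> (\<alpha> A A R \<cdot> (t \<otimes> \<one> R))) \<cdot> swap (A \<otimes>\<^sub>o A) Q R"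
        using swap_nat[of t "\<one> Q" "\<one> R" "A \<otimes>\<^sub>o A" Q R] by simp
      also have "\<dots> = (\<one> Q \<otimes> T R) \<cdot> ((\<one> Q \<otimes> \<alpha> A A R) \<cdot> swap (A \<otimes>\<^sub>o A) Q R)"
        by (simp add: whisker_right_Assoc)
      also have "\<dots> = ((\<one> Q \<otimes> T R) \<cdot> ?\<theta>) \<cdot> \<alpha> A A (Q \<otimes>\<^sub>o R)"
        by (simp add: swap_Tensor_left del: interchange interchange_pre)
      finally show "(?\<theta> \<cdot> T (Q \<otimes>\<^sub>o R)) \<cdot> \<alpha> A A (Q \<otimes>\<^sub>o R) = ((\<one> Q \<otimes> T R) \<cdot> ?\<theta>) \<cdot> \<alpha> A A (Q \<otimes>\<^sub>o R)" .
    qed simp_all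
    show "?\<theta> \<cdot> swap A A (Q \<otimes>\<^sub>o R) = (\<one> Q \<otimes> swap A A R) \<cdot> ?\<theta>"
      by (simp add: Yang_Baxter)
    show "?\<theta> \<cdot> (\<one> A \<otimes> whisker_left A Q R r) = (\<one> Q \<otimes> (\<one> A \<otimes> r)) \<cdot> ?\<theta>"
      using swap_nat[of "\<one> A" "\<one> Q" r A Q "A \<otimes>\<^sub>o R", THEN Comp_extend, of "\<one> A \<otimes> swap A Q R"]
      by (simp add: swap_whisker_left)
    show "(\<one> Q \<otimes> T R) \<cdot> inv (\<one> Q \<otimes> swap A A R) \<cdot> (\<one> Q \<otimes> (\<one> A \<otimes> r)) \<cdot> (\<one> Q \<otimes> swap A A R)
      \<cdot> (\<one> Q \<otimes> (\<one> A \<otimes> r))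
      = (\<one> Q \<otimes> (\<one> A \<otimes> r)) \<cdot> (\<one> Q \<otimes> T R)"
      using law by (simp add: fusion_law_def whisker_left_def)
  qed simp_all
qed

end

section \<open>Tensor products of modules and the action of the counit\<close>

context braided_monoidal_category
begin

text \<open>Naturality of left whiskering in the spectator object: for \<open>B = A\<close>, acting by \<open>f\<close> on \<open>Q\<close>
  does not interfere with \<open>r\<close>, which acts on \<open>R\<close>.\<close>
lemma whisker_left_commute:
  assumes [simp]: "A \<in> Obj C" "B \<in> Obj C" "Q \<in> Obj C" "Q' \<in> Obj C" "R \<in> Obj C"
    and f: "f \<in> Hom C (B \<otimes>\<^sub>o Q) Q'"
    and r: "r \<in> Hom C (A \<otimes>\<^sub>o R) (A \<otimes>\<^sub>o R)"
  shows "whisker_left A Q' R r \<cdot> (\<one> A \<otimes> ((f \<otimes> \<one> R) \<cdot> inv (\<alpha> B Q R)))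
    = (\<one> A \<otimes> ((f \<otimes> \<one> R) \<cdot> inv (\<alpha> B Q R))) \<cdot> whisker_left A B (Q \<otimes>\<^sub>o R) (whisker_left A Q R r)"
proof -
  have [simp]: "r \<in> Arr C" "Dom C r = A \<otimes>\<^sub>o R" "Cod C r = A \<otimes>\<^sub>o R"
    "f \<in> Arr C" "Dom C f = B \<otimes>\<^sub>o Q" "Cod C f = Q'" using r f by auto
  have 1: "inv (\<one> A \<otimes> \<alpha> B Q R) \<cdot> whisker_left A B (Q \<otimes>\<^sub>o R) (whisker_left A Q R r)
      = whisker_left A (B \<otimes>\<^sub>o Q) R r \<cdot> inv (\<one> A \<otimes> \<alpha> B Q R)"
    by (rule intertwine_Inv) (simp_all add: whisker_left_left)
  have 2: "(\<one> A \<otimes> (f \<otimes> \<one> R)) \<cdot> whisker_left A (B \<otimes>\<^sub>o Q) R r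
      = whisker_left A Q' R r \<cdot> (\<one> A \<otimes> (f \<otimes> \<one> R))"
    by (rule whisker_left_nat) simp_all
  have "whisker_left A Q' R r \<cdot> (\<one> A \<otimes> ((f \<otimes> \<one> R) \<cdot> inv (\<alpha> B Q R)))
      = (whisker_left A Q' R r \<cdot> (\<one> A \<otimes> (f \<otimes> \<one> R))) \<cdot> inv (\<one> A \<otimes> \<alpha> B Q R)"
    by simp
  also have "\<dots> = (\<one> A \<otimes> (f \<otimes> \<one> R)) \<cdot> (whisker_left A (B \<otimes>\<^sub>o Q) R r \<cdot> inv (\<one> A \<otimes> \<alpha> B Q R))"
    by (simp only: 2[symmetric]) simp
  also have "\<dots> = (\<one> A \<otimes> ((f \<otimes> \<one> R) \<cdot> inv (\<alpha> B Q R)))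
    \<cdot> whisker_left A B (Q \<otimes>\<^sub>o R) (whisker_left A Q R r)"
    by (simp only: 1[symmetric]) simp
  finally show ?thesis .
qed

text \<open>In Sweedler notation, \<open>a \<otimes> x \<otimes> y \<mapsto> a\<^sub>1 \<otimes> a\<^sub>2 x \<otimes> a\<^sub>3 y\<close>.\<close>
definition module_tensor where
  "module_tensor A Q q R r = whisker_right A Q R q \<cdot> whisker_left A Q R r"

lemma module_tensor_simps [simp]:
  assumes "A \<in> Obj C" "Q \<in> Obj C" "q \<in> Arr C" "Dom C q = A \<otimes>\<^sub>o Q" "Cod C q = A \<otimes>\<^sub>o Q"
    "R \<in> Obj C" "r \<in> Arr C" "Dom C r = A \<otimes>\<^sub>o R" "Cod C r = A \<otimes>\<^sub>o R"
  shows "module_tensor A Q q R r \<in> Arr C" "Dom C (module_tensor A Q q R r) = A \<otimes>\<^sub>o (Q \<otimes>\<^sub>o R)"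
    "Cod C (module_tensor A Q q R r) = A \<otimes>\<^sub>o (Q \<otimes>\<^sub>o R)"
  using assms by (simp_all add: module_tensor_def)

lemma module_tensor_nat:
  assumes [simp]: "A \<in> Obj C" "Q \<in> Obj C" "R \<in> Obj C" "Q' \<in> Obj C" "R' \<in> Obj C"
    and "q \<in> Hom C (A \<otimes>\<^sub>o Q) (A \<otimes>\<^sub>o Q)" "q' \<in> Hom C (A \<otimes>\<^sub>o Q') (A \<otimes>\<^sub>o Q')"
    "r \<in> Hom C (A \<otimes>\<^sub>o R) (A \<otimes>\<^sub>o R)" "r' \<in> Hom C (A \<otimes>\<^sub>o R') (A \<otimes>\<^sub>o R')"
    "f \<in> Hom C Q Q'" "g \<in> Hom C R R'"
    and f: "(\<one> A \<otimes> f) \<cdot> q = q' \<cdot> (\<one> A \<otimes> f)" and g: "(\<one> A \<otimes> g) \<cdot> r = r' \<cdot> (\<one> A \<otimes> g)"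
  shows "(\<one> A \<otimes> (f \<otimes> g)) \<cdot> module_tensor A Q q R r = module_tensor A Q' q' R' r' \<cdot> (\<one> A \<otimes> (f \<otimes> g))"
proof -
  have [simp]: "q \<in> Arr C" "Dom C q = A \<otimes>\<^sub>o Q" "Cod C q = A \<otimes>\<^sub>o Q" "q' \<in> Arr C"
    "Dom C q' = A \<otimes>\<^sub>o Q'" "Cod C q' = A \<otimes>\<^sub>o Q'"
    "r \<in> Arr C" "Dom C r = A \<otimes>\<^sub>o R" "Cod C r = A \<otimes>\<^sub>o R" "r' \<in> Arr C" "Dom C r' = A \<otimes>\<^sub>o R'"
      "Cod C r' = A \<otimes>\<^sub>o R'"
    "f \<in> Arr C" "Dom C f = Q" "Cod C f = Q'" "g \<in> Arr C" "Dom C g = R" "Cod C g = R'"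
    using assms by auto
  have 1: "(\<one> A \<otimes> (f \<otimes> g)) \<cdot> whisker_right A Q R q = whisker_right A Q' R' q' \<cdot> (\<one> A \<otimes> (f \<otimes> g))"
    by (rule whisker_right_nat) (simp_all add: f)
  have 2: "(\<one> A \<otimes> (f \<otimes> g)) \<cdot> whisker_left A Q R r = whisker_left A Q' R' r' \<cdot> (\<one> A \<otimes> (f \<otimes> g))"
    by (rule whisker_left_nat) (simp_all add: g)
  show ?thesis
    by (simp add: module_tensor_def 1[THEN Comp_extend] 2)
qed

text \<open>Expanding both sides gives three whiskered factors, one for each of \<open>q\<close>, \<open>r\<close>, \<open>s\<close>, and
  \<open>\<alpha> Q R S\<close> intertwines them one at a time.\<close>
lemma module_tensor_assoc:
  assumes [simp]: "A \<in> Obj C" "Q \<in> Obj C" "R \<in> Obj C" "S \<in> Obj C"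
    and "q \<in> Hom C (A \<otimes>\<^sub>o Q) (A \<otimes>\<^sub>o Q)" "r \<in> Hom C (A \<otimes>\<^sub>o R) (A \<otimes>\<^sub>o R)"
      "s \<in> Hom C (A \<otimes>\<^sub>o S) (A \<otimes>\<^sub>o S)"
  shows "(\<one> A \<otimes> \<alpha> Q R S) \<cdot> module_tensor A (Q \<otimes>\<^sub>o R) (module_tensor A Q q R r) S s
    = module_tensor A Q q (R \<otimes>\<^sub>o S) (module_tensor A R r S s) \<cdot> (\<one> A \<otimes> \<alpha> Q R S)"
proof -
  have [simp]: "q \<in> Arr C" "Dom C q = A \<otimes>\<^sub>o Q" "Cod C q = A \<otimes>\<^sub>o Q"
    "r \<in> Arr C" "Dom C r = A \<otimes>\<^sub>o R" "Cod C r = A \<otimes>\<^sub>o R" "s \<in> Arr C" "Dom C s = A \<otimes>\<^sub>o S"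
      "Cod C s = A \<otimes>\<^sub>o S"
    using assms by auto
  show ?thesis
    by (simp add: module_tensor_def whisker_right_Comp whisker_left_Comp
      whisker_right_right[THEN Comp_extend] whisker_right_left[THEN Comp_extend] whisker_left_left)
qed

lemma module_tensor_LUnit:
  assumes [simp]: "A \<in> Obj C" "Q \<in> Obj C" and "q \<in> Hom C (A \<otimes>\<^sub>o Q) (A \<otimes>\<^sub>o Q)"
  shows "(\<one> A \<otimes> \<lambda>\<^sub>l Q) \<cdot> module_tensor A \<I> (\<one> (A \<otimes>\<^sub>o \<I>)) Q q = q \<cdot> (\<one> A \<otimes> \<lambda>\<^sub>l Q)"
proof -
  have [simp]: "q \<in> Arr C" "Dom C q = A \<otimes>\<^sub>o Q" "Cod C q = A \<otimes>\<^sub>o Q" using assms by auto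
  have "(\<one> A \<otimes> \<lambda>\<^sub>l Q) \<cdot> module_tensor A \<I> (\<one> (A \<otimes>\<^sub>o \<I>)) Q q
      = \<lambda>\<^sub>l (A \<otimes>\<^sub>o Q) \<cdot> swap A \<I> Q \<cdot> whisker_left A \<I> Q q"
    by (simp add: module_tensor_def whisker_right_Id swap_Unit_middle[THEN Comp_extend])
  also have "\<dots> = q \<cdot> \<lambda>\<^sub>l (A \<otimes>\<^sub>o Q) \<cdot> swap A \<I> Q"
    by (simp add: swap_whisker_left LUnit_nat[THEN Comp_extend])
  finally show ?thesis by (simp add: swap_Unit_middle)
qed

lemma module_tensor_RUnit:
  assumes [simp]: "A \<in> Obj C" "Q \<in> Obj C" and "q \<in> Hom C (A \<otimes>\<^sub>o Q) (A \<otimes>\<^sub>o Q)"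
  shows "(\<one> A \<otimes> \<rho>\<^sub>r Q) \<cdot> module_tensor A Q q \<I> (\<one> (A \<otimes>\<^sub>o \<I>)) = q \<cdot> (\<one> A \<otimes> \<rho>\<^sub>r Q)"
proof (rule iso_cancel_right[of "\<alpha> A Q \<I>"], goal_cases)
  case 6
  have [simp]: "q \<in> Arr C" "Dom C q = A \<otimes>\<^sub>o Q" "Cod C q = A \<otimes>\<^sub>o Q" using assms by auto
  show ?case
    by (simp add: module_tensor_def whisker_left_Id whisker_right_Assoc
      RUnit_Tensor[THEN Comp_extend] RUnit_Tensor RUnit_nat)
qed (use assms in simp_all)

lemma counit_left_simps [simp]:
  assumes "e \<in> Arr C" "Cod C e = \<I>" "X \<in> Obj C"
  shows "counit_left C e X \<in> Arr C" "Dom C (counit_left C e X) = Dom C e \<otimes>\<^sub>o X"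
    "Cod C (counit_left C e X) = X"
  using assms by (simp_all add: counit_left_def)

lemma counit_left_nat:
  assumes "e \<in> Arr C" "Cod C e = \<I>" "f \<in> Arr C" "Dom C e = B" "Cod C f = Y"
  shows "counit_left C e Y \<cdot> (\<one> B \<otimes> f) = f \<cdot> counit_left C e (Dom C f)"
proof -
  have "counit_left C e Y \<cdot> (\<one> B \<otimes> f) = \<lambda>\<^sub>l Y \<cdot> (\<one> \<I> \<otimes> f) \<cdot> (e \<otimes> \<one> (Dom C f))"
    using assms by (auto simp add: counit_left_def)
  also have "\<dots> = f \<cdot> counit_left C e (Dom C f)"
    using assms by (auto simp add: counit_left_def LUnit_nat[THEN Comp_extend] simp del:
      interchange)
  finally show ?thesis .
qed

lemma counit_left_Assoc:
  assumes [simp]: "e \<in> Arr C" "Cod C e = \<I>" "X \<in> Obj C" "Y \<in> Obj C"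
    and [symmetric, simp]: "Dom C e = B"
  shows "counit_left C e (X \<otimes>\<^sub>o Y) \<cdot> \<alpha> B X Y = counit_left C e X \<otimes> \<one> Y"
proof -
  have "counit_left C e (X \<otimes>\<^sub>o Y) \<cdot> \<alpha> B X Y = \<lambda>\<^sub>l (X \<otimes>\<^sub>o Y) \<cdot> \<alpha> \<I> X Y \<cdot> ((e \<otimes> \<one> X) \<otimes> \<one> Y)"
    by (simp add: counit_left_def Assoc_nat_left)
  also have "\<dots> = counit_left C e X \<otimes> \<one> Y"
    by (simp add: counit_left_def LUnit_Tensor[THEN Comp_extend])
  finally show ?thesis .
qed

text \<open>Since \<open>e\<close> takes values in the unit, it makes no difference whether \<open>B\<close> is moved past \<open>X\<close>
  before \<open>e\<close> removes it.\<close>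
lemma counit_left_swap_outer:
  assumes [simp]: "e \<in> Arr C" "Cod C e = \<I>" "X \<in> Obj C" "Y \<in> Obj C"
    and [symmetric, simp]: "Dom C e = B"
  shows "(\<one> X \<otimes> counit_left C e Y) \<cdot> swap B X Y = counit_left C e (X \<otimes>\<^sub>o Y)"
proof -
  have "(\<one> X \<otimes> counit_left C e Y) \<cdot> swap B X Y = (\<one> X \<otimes> \<lambda>\<^sub>l Y) \<cdot> (\<one> X \<otimes> (e \<otimes> \<one> Y)) \<cdot> swap B X Y"
    by (simp add: counit_left_def)
  also have "\<dots> = (\<one> X \<otimes> \<lambda>\<^sub>l Y) \<cdot> swap \<I> X Y \<cdot> (e \<otimes> \<one> (X \<otimes>\<^sub>o Y))"
    using swap_nat[of e "\<one> X" "\<one> Y" \<I> X Y] by simp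
  also have "\<dots> = counit_left C e (X \<otimes>\<^sub>o Y)"
    by (simp add: counit_left_def swap_Unit_left[THEN Comp_extend])
  finally show ?thesis .
qed

lemma counit_left_swap_inner:
  assumes [simp]: "e \<in> Arr C" "Cod C e = \<I>" "X \<in> Obj C" "Y \<in> Obj C"
    and [symmetric, simp]: "Dom C e = B"
  shows "counit_left C e (X \<otimes>\<^sub>o Y) \<cdot> swap X B Y = \<one> X \<otimes> counit_left C e Y"
proof -
  have "counit_left C e (X \<otimes>\<^sub>o Y) \<cdot> swap X B Y = \<lambda>\<^sub>l (X \<otimes>\<^sub>o Y) \<cdot> (e \<otimes> \<one> (X \<otimes>\<^sub>o Y)) \<cdot> swap X B Y"
    by (simp add: counit_left_def)
  also have "\<dots> = \<lambda>\<^sub>l (X \<otimes>\<^sub>o Y) \<cdot> swap X \<I> Y \<cdot> (\<one> X \<otimes> (e \<otimes> \<one> Y))"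
    using swap_nat[of "\<one> X" e "\<one> Y" X \<I> Y] by simp
  also have "\<dots> = \<one> X \<otimes> counit_left C e Y"
    by (simp add: counit_left_def swap_Unit_middle[THEN Comp_extend])
  finally show ?thesis .
qed

end

section \<open>Tensor products satisfy the module axioms\<close>

context counital_fusion
begin

text \<open>The commutation hypothesis says that the factor of \<open>r\<close> on positions 1 and 3 commutes with
  the factor of \<open>q\<close> on positions 2 and 3. This is all that is needed to sort the product into
  the two given fusion equations.\<close>
lemma fusion_law_Comp:
  assumes [simp]: "X \<in> Obj C" and "q \<in> Hom C (A \<otimes>\<^sub>o X) (A \<otimes>\<^sub>o X)" "r \<in> Hom C (A \<otimes>\<^sub>o X) (A \<otimes>\<^sub>o X)"
    and q: "fusion_law X q" and r: "fusion_law X r"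
    and c: "whisker_left A A X r \<cdot> (\<one> A \<otimes> q) = (\<one> A \<otimes> q) \<cdot> whisker_left A A X r"
  shows "fusion_law X (q \<cdot> r)"
proof -
  have [simp]: "q \<in> Arr C" "Dom C q = A \<otimes>\<^sub>o X" "Cod C q = A \<otimes>\<^sub>o X" "r \<in> Arr C" "Dom C r = A \<otimes>\<^sub>o X"
    "Cod C r = A \<otimes>\<^sub>o X"
    using assms by auto
  note Q = q[unfolded fusion_law_def] and R = r[unfolded fusion_law_def]
  have "T X \<cdot> whisker_left A A X (q \<cdot> r) \<cdot> (\<one> A \<otimes> (q \<cdot> r))
      = T X \<cdot> whisker_left A A X q \<cdot> (whisker_left A A X r \<cdot> (\<one> A \<otimes> q)) \<cdot> (\<one> A \<otimes> r)"
    by (simp add: whisker_left_Comp)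
  also have "\<dots> = (T X \<cdot> whisker_left A A X q \<cdot> (\<one> A \<otimes> q)) \<cdot> whisker_left A A X r \<cdot> (\<one> A \<otimes> r)"
    unfolding c by simp
  also have "\<dots> = (\<one> A \<otimes> q) \<cdot> (T X \<cdot> whisker_left A A X r \<cdot> (\<one> A \<otimes> r))"
    unfolding Q by simp
  also have "\<dots> = (\<one> A \<otimes> (q \<cdot> r)) \<cdot> T X"
    unfolding R by simp
  finally show ?thesis unfolding fusion_law_def .
qed

lemma fusion_law_module_tensor:
  assumes [simp]: "Q \<in> Obj C" "R \<in> Obj C" and q: "q \<in> Hom C (A \<otimes>\<^sub>o Q) (A \<otimes>\<^sub>o Q)" "fusion_law Q q"
    and r: "r \<in> Hom C (A \<otimes>\<^sub>o R) (A \<otimes>\<^sub>o R)" "fusion_law R r"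
  shows "fusion_law (Q \<otimes>\<^sub>o R) (module_tensor A Q q R r)"
  unfolding module_tensor_def
proof (rule fusion_law_Comp, goal_cases)
  case 6
  have [simp]: "q \<in> Arr C" "Dom C q = A \<otimes>\<^sub>o Q" "Cod C q = A \<otimes>\<^sub>o Q" "r \<in> Arr C" "Dom C r = A \<otimes>\<^sub>o R"
    "Cod C r = A \<otimes>\<^sub>o R"
    using assms by auto
  let ?r = "whisker_left A Q R r" and ?X = "Q \<otimes>\<^sub>o R"
  have a: "whisker_left A A ?X ?r \<cdot> (\<one> A \<otimes> \<alpha> A Q R) = (\<one> A \<otimes> \<alpha> A Q R)
    \<cdot> whisker_left A (A \<otimes>\<^sub>o Q) R r"
    by (simp add: whisker_left_left)
  have b: "whisker_left A (A \<otimes>\<^sub>o Q) R r \<cdot> (\<one> A \<otimes> ((q \<otimes> \<one> R) \<cdot> inv (\<alpha> A Q R)))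
    = (\<one> A \<otimes> ((q \<otimes> \<one> R) \<cdot> inv (\<alpha> A Q R))) \<cdot> whisker_left A A ?X ?r"
    by (rule whisker_left_commute) simp_all
  have "whisker_left A A ?X ?r \<cdot> (\<one> A \<otimes> whisker_right A Q R q)
      = (whisker_left A A ?X ?r \<cdot> (\<one> A \<otimes> \<alpha> A Q R)) \<cdot> (\<one> A \<otimes> ((q \<otimes> \<one> R) \<cdot> inv (\<alpha> A Q R)))"
    by (simp add: whisker_right_def)
  also have "\<dots> = (\<one> A \<otimes> \<alpha> A Q R) \<cdot> whisker_left A (A \<otimes>\<^sub>o Q) R r
    \<cdot> (\<one> A \<otimes> ((q \<otimes> \<one> R) \<cdot> inv (\<alpha> A Q R)))"
    unfolding a by simp
  also have "\<dots> = (\<one> A \<otimes> whisker_right A Q R q) \<cdot> whisker_left A A ?X ?r"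
    unfolding b by (simp add: whisker_right_def)
  finally show ?case .
qed (use assms in \<open>simp_all add: fusion_law_whisker_right fusion_law_whisker_left\<close>)

text \<open>The counit axiom \<open>(1 \<otimes> e) t = 1 \<otimes> e\<close> with a spectator \<open>Q\<close> on the right.\<close>
lemma counit_T:
  assumes [simp]: "Q \<in> Obj C"
  shows "(\<one> A \<otimes> \<epsilon> Q) \<cdot> T Q = \<one> A \<otimes> \<epsilon> Q"
proof (rule iso_cancel_right[of "\<alpha> A A Q"], goal_cases)
  case 6
  have n: "(\<one> A \<otimes> (e \<otimes> \<one> Q)) \<cdot> \<alpha> A A Q = \<alpha> A \<I> Q \<cdot> ((\<one> A \<otimes> e) \<otimes> \<one> Q)"
    by (simp add: Assoc_nat)
  have "((\<one> A \<otimes> \<epsilon> Q) \<cdot> T Q) \<cdot> \<alpha> A A Q = (\<one> A \<otimes> \<lambda>\<^sub>l Q) \<cdot> ((\<one> A \<otimes> (e \<otimes> \<one> Q)) \<cdot> \<alpha> A A Q) \<cdot> (t \<otimes> \<one> Q)"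
    by (simp add: whisker_right_Assoc counit_left_def)
  also have "\<dots> = (\<one> A \<otimes> \<lambda>\<^sub>l Q) \<cdot> \<alpha> A \<I> Q \<cdot> ((\<one> A \<otimes> e) \<otimes> \<one> Q)"
    unfolding n by (simp add: counit_t)
  also have "\<dots> = (\<one> A \<otimes> \<epsilon> Q) \<cdot> \<alpha> A A Q"
    by (simp add: n[symmetric] counit_left_def)
  finally show ?case .
qed simp_all

text \<open>Apply the counit to the second factor of the fusion equation. On the left it absorbs the
  leading \<open>T Q\<close> by the counit axiom, and it slides through the factor on positions 1 and 3,
  which thereby becomes \<open>q\<close>.\<close>
lemma fusion_law_action:
  assumes [simp]: "Q \<in> Obj C" and q: "q \<in> Hom C (A \<otimes>\<^sub>o Q) (A \<otimes>\<^sub>o Q)" and law: "fusion_law Q q"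
  shows "q \<cdot> (\<one> A \<otimes> (\<epsilon> Q \<cdot> q)) = (\<one> A \<otimes> (\<epsilon> Q \<cdot> q)) \<cdot> T Q"
proof -
  have [simp]: "q \<in> Arr C" "Dom C q = A \<otimes>\<^sub>o Q" "Cod C q = A \<otimes>\<^sub>o Q" using q by auto
  have i: "(\<one> A \<otimes> \<epsilon> Q) \<cdot> inv (swap A A Q) = \<epsilon> (A \<otimes>\<^sub>o Q)"
    by (rule iso_cancel_right[of "swap A A Q"]) (simp_all add: counit_left_swap_inner)
  have "(\<one> A \<otimes> (\<epsilon> Q \<cdot> q)) \<cdot> T Q = (\<one> A \<otimes> \<epsilon> Q) \<cdot> ((\<one> A \<otimes> q) \<cdot> T Q)"
    by simp
  also have "\<dots> = (\<one> A \<otimes> \<epsilon> Q) \<cdot> T Q \<cdot> whisker_left A A Q q \<cdot> (\<one> A \<otimes> q)"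
    using law by (simp add: fusion_law_def)
  also have "\<dots> = (\<one> A \<otimes> \<epsilon> Q) \<cdot> whisker_left A A Q q \<cdot> (\<one> A \<otimes> q)"
    by (simp add: counit_T[THEN Comp_extend])
  also have "\<dots> = \<epsilon> (A \<otimes>\<^sub>o Q) \<cdot> (\<one> A \<otimes> q) \<cdot> swap A A Q \<cdot> (\<one> A \<otimes> q)"
    by (simp add: whisker_left_def i[THEN Comp_extend])
  also have "\<dots> = q \<cdot> (\<epsilon> (A \<otimes>\<^sub>o Q) \<cdot> swap A A Q) \<cdot> (\<one> A \<otimes> q)"
    by (simp add: counit_left_nat[THEN Comp_extend])
  also have "\<dots> = q \<cdot> (\<one> A \<otimes> (\<epsilon> Q \<cdot> q))"
    by (simp add: counit_left_swap_inner)
  finally show ?thesis by simp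
qed

text \<open>In Sweedler notation, \<open>a \<otimes> b \<otimes> c \<mapsto> b\<^sub>1 a \<otimes> b\<^sub>2 c\<close>.\<close>
abbreviation density_map where
  "density_map \<equiv> (fusion_mult C A t e \<otimes> \<one> A) \<cdot> (inv (\<b> A A) \<otimes> \<one> A) \<cdot> on_last_two C A A A t"

text \<open>The map \<open>density_map\<close> with a spectator \<open>X\<close>, on right-nested products; the first two
  factors \<open>\<epsilon> \<cdot> T\<close> form the multiplication of \<open>A\<close> with spectator \<open>A \<otimes> X\<close>.\<close>
definition density_map_on where
  "density_map_on X = \<epsilon> (A \<otimes>\<^sub>o (A \<otimes>\<^sub>o X)) \<cdot> T (A \<otimes>\<^sub>o X) \<cdot> inv (swap A A (A \<otimes>\<^sub>o X)) \<cdot> (\<one> A \<otimes> T X)"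

lemma density_map_on_Assoc:
  assumes [simp]: "X \<in> Obj C"
  shows "density_map_on X \<cdot> (\<one> A \<otimes> \<alpha> A A X) \<cdot> \<alpha> A (A \<otimes>\<^sub>o A) X \<cdot> (\<alpha> A A A \<otimes> \<one> X)
    = \<alpha> A A X \<cdot> (density_map \<otimes> \<one> X)"
proof -
  let ?m = "fusion_mult C A t e" and ?Y = "A \<otimes>\<^sub>o X"
  have [simp]: "?m \<in> Arr C" "Dom C ?m = A \<otimes>\<^sub>o A" "Cod C ?m = A"
    by (simp_all add: fusion_mult_def)
  have m: "\<epsilon> (A \<otimes>\<^sub>o ?Y) \<cdot> T ?Y = (?m \<otimes> \<one> ?Y) \<cdot> inv (\<alpha> A A ?Y)"
    by (simp add: whisker_right_def counit_left_Assoc[THEN Comp_extend] fusion_mult_def)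
  have s: "inv (swap A A ?Y) = \<alpha> A A ?Y \<cdot> (inv (\<b> A A) \<otimes> \<one> ?Y) \<cdot> inv (\<alpha> A A ?Y)"
    by (rule isoI(2)) (simp_all add: swap_def)
  have D: "density_map_on X = ((?m \<cdot> inv (\<b> A A)) \<otimes> \<one> ?Y) \<cdot> inv (\<alpha> A A ?Y) \<cdot> (\<one> A \<otimes> T X)"
    unfolding density_map_on_def by (simp add: m[THEN Comp_extend] s)
  have n: "(\<one> A \<otimes> (t \<otimes> \<one> X)) \<cdot> \<alpha> A (A \<otimes>\<^sub>o A) X \<cdot> (\<alpha> A A A \<otimes> \<one> X)
      = \<alpha> A (A \<otimes>\<^sub>o A) X \<cdot> (((\<one> A \<otimes> t) \<cdot> \<alpha> A A A) \<otimes> \<one> X)"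
    using Assoc_nat[of "\<one> A" t "\<one> X" A "A \<otimes>\<^sub>o A" X, symmetric, THEN Comp_extend, of
      "\<alpha> A A A \<otimes> \<one> X"] by simp
  have "density_map_on X \<cdot> (\<one> A \<otimes> \<alpha> A A X) \<cdot> \<alpha> A (A \<otimes>\<^sub>o A) X \<cdot> (\<alpha> A A A \<otimes> \<one> X)
      = ((?m \<cdot> inv (\<b> A A)) \<otimes> \<one> ?Y) \<cdot> inv (\<alpha> A A ?Y) \<cdot> (\<one> A \<otimes> \<alpha> A A X) \<cdot> (\<one> A \<otimes> (t \<otimes> \<one> X)) \<cdot> \<alpha> A
        (A \<otimes>\<^sub>o A) X \<cdot> (\<alpha> A A A \<otimes> \<one> X)"
    unfolding D by (simp add: whisker_right_Assoc)
  also have "\<dots> = ((?m \<cdot> inv (\<b> A A)) \<otimes> \<one> ?Y) \<cdot> inv (\<alpha> A A ?Y)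
    \<cdot> ((\<one> A \<otimes> \<alpha> A A X) \<cdot> \<alpha> A (A \<otimes>\<^sub>o A) X \<cdot> (\<alpha> A A A \<otimes> \<one> X)) \<cdot> (on_last_two C A A A t \<otimes> \<one> X)"
    using n by (simp add: on_last_two_def del: interchange_pre)
  also have "\<dots> = ((?m \<cdot> inv (\<b> A A)) \<otimes> \<one> ?Y) \<cdot> \<alpha> (A \<otimes>\<^sub>o A) A X \<cdot> (on_last_two C A A A t \<otimes> \<one> X)"
    by (simp only: pentagon[of A A A X, OF A_t_e_simps(1) A_t_e_simps(1) A_t_e_simps(1) assms])
      (simp add: on_last_two_def)
  also have "\<dots> = \<alpha> A A X \<cdot> (((?m \<cdot> inv (\<b> A A)) \<otimes> \<one> A) \<otimes> \<one> X) \<cdot> (on_last_two C A A A t \<otimes> \<one> X)"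
    by (simp add: Assoc_nat_left[THEN Comp_extend] on_last_two_def del: interchange interchange_pre)
  also have "\<dots> = \<alpha> A A X \<cdot> (density_map \<otimes> \<one> X)"
    by (simp add: on_last_two_def)
  finally show ?thesis .
qed

lemma split_epi_density_map_on:
  assumes [simp]: "X \<in> Obj C" and d: "split_epi C density_map"
  shows "split_epi C (density_map_on X)"
proof -
  have [simp]: "density_map \<in> Arr C" using d by (simp add: split_epi_def)
  have dc: "Cod C density_map = A \<otimes>\<^sub>o A" by (simp add: on_last_two_def fusion_mult_def)
  have [simp]: "density_map_on X \<in> Arr C" "Dom C (density_map_on X)
    = A \<otimes>\<^sub>o (A \<otimes>\<^sub>o (A \<otimes>\<^sub>o X))" by (simp_all add: density_map_on_def)
  have "split_epi C (\<alpha> A A X \<cdot> (density_map \<otimes> \<one> X))"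
    by (intro split_epi_Comp split_epi_Tensor split_epi_iso d) (simp_all add: dc del: Comp_assoc')
  then show ?thesis
    unfolding density_map_on_Assoc[OF assms(1), symmetric] by (rule split_epi_Comp_left) simp_all
qed

text \<open>Let \<open>X = Q \<otimes> R\<close>, with the two commuting actions \<open>k\<close> of \<open>A\<close> on the factor \<open>Q\<close> and \<open>l\<close> on
  the factor \<open>R\<close>, both of them split epimorphisms. The action \<open>?u\<close> on the tensor product is the
  diagonal one. Feeding it with \<open>k (a, l (c, z))\<close>, where \<open>z\<close> is in \<open>X\<close>, gives \<open>b\<^sub>1 a\<close> acting
  through \<open>k\<close> and \<open>b\<^sub>2 c\<close> acting through \<open>l\<close>, that is, \<open>k (1 \<otimes> l)\<close> after \<open>density_map_on X\<close>, a
  composite of split epimorphisms.\<close>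
lemma split_epi_module_tensor:
  assumes [simp]: "Q \<in> Obj C" "R \<in> Obj C" and q: "q \<in> Hom C (A \<otimes>\<^sub>o Q) (A \<otimes>\<^sub>o Q)" "fusion_law Q q"
    "split_epi C (\<epsilon> Q \<cdot> q)"
    and r: "r \<in> Hom C (A \<otimes>\<^sub>o R) (A \<otimes>\<^sub>o R)" "fusion_law R r" "split_epi C (\<epsilon> R \<cdot> r)"
    and d: "split_epi C density_map"
  shows "split_epi C (\<epsilon> (Q \<otimes>\<^sub>o R) \<cdot> module_tensor A Q q R r)"
proof -
  have [simp]: "q \<in> Arr C" "Dom C q = A \<otimes>\<^sub>o Q" "Cod C q = A \<otimes>\<^sub>o Q" "r \<in> Arr C" "Dom C r = A \<otimes>\<^sub>o R"
    "Cod C r = A \<otimes>\<^sub>o R"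
    using assms by auto
  define X where "X = Q \<otimes>\<^sub>o R"
  define q' where "q' = whisker_right A Q R q"
  define r' where "r' = whisker_left A Q R r"
  have [simp]: "X \<in> Obj C" "q' \<in> Arr C" "Dom C q' = A \<otimes>\<^sub>o X" "Cod C q' = A \<otimes>\<^sub>o X"
    "r' \<in> Arr C" "Dom C r' = A \<otimes>\<^sub>o X" "Cod C r' = A \<otimes>\<^sub>o X"
    by (simp_all add: X_def q'_def r'_def)
  define k where "k = \<epsilon> X \<cdot> q'"
  define l where "l = \<epsilon> X \<cdot> r'"
  have [simp]: "k \<in> Arr C" "Dom C k = A \<otimes>\<^sub>o X" "Cod C k = X" "l \<in> Arr C" "Dom C l = A \<otimes>\<^sub>o X"
    "Cod C l = X"
    by (simp_all add: k_def l_def)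
  have k: "k = ((\<epsilon> Q \<cdot> q) \<otimes> \<one> R) \<cdot> inv (\<alpha> A Q R)"
    by (simp add: k_def X_def q'_def whisker_right_def counit_left_Assoc[THEN Comp_extend])
  have i: "\<epsilon> (Q \<otimes>\<^sub>o R) \<cdot> inv (swap A Q R) = \<one> Q \<otimes> \<epsilon> R"
    by (rule iso_cancel_right[of "swap A Q R"]) (simp_all add: counit_left_swap_outer)
  have l: "l = (\<one> Q \<otimes> (\<epsilon> R \<cdot> r)) \<cdot> swap A Q R"
    by (simp add: l_def X_def r'_def whisker_left_def i[THEN Comp_extend])
  have kk: "q' \<cdot> (\<one> A \<otimes> k) = (\<one> A \<otimes> k) \<cdot> T X"
    unfolding k_def by (rule fusion_law_action) (simp_all add: X_def q'_def
      fusion_law_whisker_right q)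
  have ll: "r' \<cdot> (\<one> A \<otimes> l) = (\<one> A \<otimes> l) \<cdot> T X"
    unfolding l_def by (rule fusion_law_action) (simp_all add: X_def r'_def
      fusion_law_whisker_left r)
  have rk: "r' \<cdot> (\<one> A \<otimes> k) = (\<one> A \<otimes> k) \<cdot> whisker_left A A X r'"
    unfolding k X_def r'_def by (rule whisker_left_commute) simp_all
  have Tn: "T X \<cdot> (\<one> A \<otimes> (\<one> A \<otimes> l)) = (\<one> A \<otimes> (\<one> A \<otimes> l)) \<cdot> T (A \<otimes>\<^sub>o X)"
    by (rule whisker_right_nat[symmetric]) simp_all
  have sn: "inv (swap A A X) \<cdot> (\<one> A \<otimes> (\<one> A \<otimes> l)) = (\<one> A \<otimes> (\<one> A \<otimes> l)) \<cdot> inv (swap A A (A \<otimes>\<^sub>o X))"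
    by (rule intertwine_Inv) (simp_all add: swap_nat)
  let ?u = "\<epsilon> X \<cdot> q' \<cdot> r'"
  let ?w = "(\<one> A \<otimes> k) \<cdot> inv (swap A A X) \<cdot> (\<one> A \<otimes> (\<one> A \<otimes> l))"
  have "?u \<cdot> ?w = \<epsilon> X \<cdot> q' \<cdot> (r' \<cdot> (\<one> A \<otimes> k)) \<cdot> inv (swap A A X) \<cdot> (\<one> A \<otimes> (\<one> A \<otimes> l))"
    by simp
  also have "\<dots> = \<epsilon> X \<cdot> (q' \<cdot> (\<one> A \<otimes> k)) \<cdot> inv (swap A A X) \<cdot> (\<one> A \<otimes> (r' \<cdot> (\<one> A \<otimes> l)))"
    unfolding rk by (simp add: whisker_left_def)
  also have "\<dots> = (\<epsilon> X \<cdot> (\<one> A \<otimes> k)) \<cdot> T X \<cdot> (inv (swap A A X) \<cdot> (\<one> A \<otimes> (\<one> A \<otimes> l))) \<cdot> (\<one> A \<otimes> T X)"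
    unfolding kk ll by simp
  also have "\<dots> = k \<cdot> \<epsilon> (A \<otimes>\<^sub>o X) \<cdot> (T X \<cdot> (\<one> A \<otimes> (\<one> A \<otimes> l))) \<cdot> inv (swap A A (A \<otimes>\<^sub>o X))
    \<cdot> (\<one> A \<otimes> T X)"
    unfolding sn by (simp add: counit_left_nat)
  also have "\<dots> = (k \<cdot> (\<one> A \<otimes> l)) \<cdot> density_map_on X"
    unfolding Tn density_map_on_def by (simp add: counit_left_nat[THEN Comp_extend])
  finally have uw: "?u \<cdot> ?w = (k \<cdot> (\<one> A \<otimes> l)) \<cdot> density_map_on X" .
  have "split_epi C k"
    unfolding k by (intro split_epi_Comp split_epi_Tensor split_epi_iso q) simp_all
  moreover have "split_epi C l"
    unfolding l by (intro split_epi_Comp split_epi_Tensor split_epi_iso r) simp_all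
  ultimately have "split_epi C (k \<cdot> (\<one> A \<otimes> l))"
    by (simp add: split_epi_Comp split_epi_Tensor split_epi_iso)
  then have "split_epi C ((k \<cdot> (\<one> A \<otimes> l)) \<cdot> density_map_on X)"
    by (rule split_epi_Comp[OF split_epi_density_map_on[OF \<open>X \<in> Obj C\<close> d]]) (simp_all add:
      density_map_on_def)
  then have "split_epi C ?u"
    unfolding uw[symmetric] by (rule split_epi_Comp_left) simp_all
  then show ?thesis
    by (simp add: X_def q'_def r'_def module_tensor_def)
qed

end

section \<open>The monoidal category of modules\<close>

locale monoidal_fusion = counital_fusion C A t e
  for C :: "('o, 'm) braided_monoidal_category" (structure) and A :: 'o and t e :: 'm +
  assumes e_split: "split_epi C e" and d_split: "split_epi C density_map"
begin

definition is_module where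
  "is_module X \<longleftrightarrow> fusion_module C A t e (fst X) (snd X)"

definition is_hom where
  "is_hom X Y f \<longleftrightarrow> f \<in> Hom C (fst X) (fst Y) \<and> (\<one> A \<otimes> f) \<cdot> snd X = snd Y \<cdot> (\<one> A \<otimes> f)"

definition tensor (infix "\<odot>" 70) where
  "X \<odot> Y = (fst X \<otimes>\<^sub>o fst Y, module_tensor A (fst X) (snd X) (fst Y) (snd Y))"

definition unit_module where
  "unit_module = (\<I>, \<one> (A \<otimes>\<^sub>o \<I>))"

lemma tensor_sel [simp]:
  "fst (X \<odot> Y) = fst X \<otimes>\<^sub>o fst Y"
  "snd (X \<odot> Y) = module_tensor A (fst X) (snd X) (fst Y) (snd Y)"
  "fst unit_module = \<I>" "snd unit_module = \<one> (A \<otimes>\<^sub>o \<I>)"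
  by (simp_all add: tensor_def unit_module_def)

lemma is_module_simps [simp]:
  assumes "is_module X"
  shows "fst X \<in> Obj C" "snd X \<in> Arr C" "Dom C (snd X) = A \<otimes>\<^sub>o fst X" "Cod C (snd X) = A \<otimes>\<^sub>o fst X"
  using assms by (auto simp: is_module_def fusion_module_def)

lemma is_module_iff:
  "is_module X \<longleftrightarrow> fst X \<in> Obj C \<and> snd X \<in> Hom C (A \<otimes>\<^sub>o fst X) (A \<otimes>\<^sub>o fst X) \<and>
    fusion_law (fst X) (snd X) \<and> split_epi C (\<epsilon> (fst X) \<cdot> snd X)"
  unfolding is_module_def fusion_module_def using fusion_law_iff[of "fst X" "snd X"] by blast

lemma is_module_tensor [simp]:
  assumes "is_module X" "is_module Y"
  shows "is_module (X \<odot> Y)"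
proof -
  note m = assms[unfolded is_module_iff]
  show ?thesis
    unfolding is_module_iff using m d_split
    by (auto intro!: fusion_law_module_tensor split_epi_module_tensor)
qed

lemma is_module_unit [simp]: "is_module unit_module"
proof -
  have "split_epi C (\<lambda>\<^sub>l \<I> \<cdot> (e \<otimes> \<one> \<I>))"
    by (intro split_epi_Comp split_epi_Tensor e_split) (simp_all add: split_epi_iso)
  then show ?thesis
    by (simp add: is_module_iff fusion_law_def whisker_left_Id counit_left_def)
qed

lemma is_hom_simps:
  assumes "is_hom X Y f"
  shows "f \<in> Arr C" "Dom C f = fst X" "Cod C f = fst Y" "(\<one> A \<otimes> f) \<cdot> snd X = snd Y \<cdot> (\<one> A \<otimes> f)"
  using assms by (auto simp: is_hom_def)

lemma is_hom_Id [simp]: "is_module X \<Longrightarrow> is_hom X X (\<one> (fst X))"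
  by (simp add: is_hom_def)

lemma is_hom_Comp:
  assumes m: "is_module X" "is_module Y" "is_module Z" and f: "is_hom X Y f" and g: "is_hom Y Z g"
  shows "is_hom X Z (g \<cdot> f)"
proof -
  note [simp] = m is_hom_simps(1-3)[OF f] is_hom_simps(1-3)[OF g]
  have "(\<one> A \<otimes> (g \<cdot> f)) \<cdot> snd X = (\<one> A \<otimes> g) \<cdot> ((\<one> A \<otimes> f) \<cdot> snd X)" by simp
  also have "\<dots> = ((\<one> A \<otimes> g) \<cdot> snd Y) \<cdot> (\<one> A \<otimes> f)" unfolding is_hom_simps(4)[OF f] by simp
  also have "\<dots> = snd Z \<cdot> (\<one> A \<otimes> (g \<cdot> f))" unfolding is_hom_simps(4)[OF g] by simp
  finally show ?thesis by (simp add: is_hom_def)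
qed

lemma is_hom_Inv:
  assumes m: "is_module X" "is_module Y" and f: "is_hom X Y f" "is_iso C f"
  shows "is_hom Y X (inv f)"
proof -
  note [simp] = m is_hom_simps(1-3)[OF f(1)] f(2)
  have "inv (\<one> A \<otimes> f) \<cdot> snd Y = snd X \<cdot> inv (\<one> A \<otimes> f)"
    by (rule intertwine_Inv[OF _ _ _ _ _ _ _ _ is_hom_simps(4)[OF f(1)]]) simp_all
  moreover have "inv (\<one> A) = \<one> A" by (rule isoI(2)) simp_all
  ultimately show ?thesis by (simp add: is_hom_def)
qed

lemma is_hom_tensor:
  assumes "is_module X" "is_module Y" "is_module X'" "is_module Y'" and f: "is_hom X X' f"
    and g: "is_hom Y Y' g"
  shows "is_hom (X \<odot> Y) (X' \<odot> Y') (f \<otimes> g)"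
proof -
  note [simp] = assms(1-4) is_hom_simps(1-3)[OF f] is_hom_simps(1-3)[OF g]
  have "(\<one> A \<otimes> (f \<otimes> g)) \<cdot> module_tensor A (fst X) (snd X) (fst Y) (snd Y)
    = module_tensor A (fst X') (snd X') (fst Y') (snd Y') \<cdot> (\<one> A \<otimes> (f \<otimes> g))"
    by (rule module_tensor_nat) (simp_all add: is_hom_simps(4)[OF f] is_hom_simps(4)[OF g])
  then show ?thesis by (simp add: is_hom_def)
qed

lemma is_hom_coherence [simp]:
  assumes "is_module X"
  shows "is_hom (unit_module \<odot> X) X (\<lambda>\<^sub>l (fst X))"
    "is_hom (X \<odot> unit_module) X (\<rho>\<^sub>r (fst X))"
    "\<lbrakk>is_module Y; is_module Z\<rbrakk>
      \<Longrightarrow> is_hom ((X \<odot> Y) \<odot> Z) (X \<odot> (Y \<odot> Z)) (\<alpha> (fst X) (fst Y) (fst Z))"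
  using assms by (simp_all add: is_hom_def module_tensor_LUnit module_tensor_RUnit
    module_tensor_assoc)

definition module_monoidal_category :: "('o \<times> 'm, ('o, 'm) module_arrow) monoidal_category" where
  "module_monoidal_category = \<lparr>
    Obj = Obj (module_category C A t e), Arr = Arr (module_category C A t e),
    Dom = Dom (module_category C A t e), Cod = Cod (module_category C A t e),
    Id = Id (module_category C A t e), Comp = Comp (module_category C A t e),
    TensorO = (\<odot>),
    Tensor = (\<lambda>(X, f, X') (Y, g, Y'). (X \<odot> Y, f \<otimes> g, X' \<odot> Y')),
    Unit = unit_module,
    Assoc = (\<lambda>X Y Z. ((X \<odot> Y) \<odot> Z, \<alpha> (fst X) (fst Y) (fst Z), X \<odot> (Y \<odot> Z))),
    LUnit = (\<lambda>X. (unit_module \<odot> X, \<lambda>\<^sub>l (fst X), X)),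
    RUnit = (\<lambda>X. (X \<odot> unit_module, \<rho>\<^sub>r (fst X), X)) \<rparr>"

abbreviation "M \<equiv> module_monoidal_category"

lemma M_sel [simp]:
  "X \<in> Obj M \<longleftrightarrow> is_module X" "Id M X = (X, \<one> (fst X), X)"
  "Dom M (X, f, Y) = X" "Cod M (X, f, Y) = Y"
  "Comp M (X', g, Z) (X, f, Y) = (X, g \<cdot> f, Z)"
  "TensorO M X Y = X \<odot> Y" "Tensor M (X, f, X') (Y, g, Y') = (X \<odot> Y, f \<otimes> g, X' \<odot> Y')"
  "Unit M = unit_module"
  "Assoc M X Y Z = ((X \<odot> Y) \<odot> Z, \<alpha> (fst X) (fst Y) (fst Z), X \<odot> (Y \<odot> Z))"
  "LUnit M X = (unit_module \<odot> X, \<lambda>\<^sub>l (fst X), X)"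
  "RUnit M X = (X \<odot> unit_module, \<rho>\<^sub>r (fst X), X)"
  by (auto simp: module_monoidal_category_def module_category_def is_module_def split: prod.splits)

lemma Arr_M [simp]: "(X, f, Y) \<in> Arr M \<longleftrightarrow> is_module X \<and> is_module Y \<and> is_hom X Y f"
  by (cases X; cases Y) (auto simp: module_monoidal_category_def module_category_def is_module_def
      is_hom_def fusion_module_morphism_def)

lemma Hom_M_cases:
  assumes "x \<in> Hom M X Y"
  obtains f where "x = (X, f, Y)" "is_module X" "is_module Y" "is_hom X Y f"
    "f \<in> Arr C" "Dom C f = fst X" "Cod C f = fst Y"
  using assms is_hom_simps by (cases x) auto

lemma Arr_M_cases:
  assumes "x \<in> Arr M"
  obtains X f Y where "x = (X, f, Y)" "is_module X" "is_module Y" "is_hom X Y f"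
    "f \<in> Arr C" "Dom C f = fst X" "Cod C f = fst Y"
  using assms is_hom_simps by (cases x) auto

text \<open>An invertible module morphism has an inverse in the category of modules: intertwining
  relations can be read backwards.\<close>
lemma is_iso_M:
  assumes "is_module X" "is_module Y" "is_hom X Y f" "is_iso C f"
  shows "is_iso M (X, f, Y)"
proof -
  have "inverse_arrows M (X, f, Y) (Y, inv f, X)"
    unfolding inverse_arrows_def using assms is_hom_simps[OF assms(3)] by (simp add: is_hom_Inv)
  then show ?thesis unfolding is_iso_def by blast
qed

sublocale modules: monoidal_category M
  by unfold_locales
    ((elim Hom_M_cases Arr_M_cases)?; auto simp: is_hom_Comp is_hom_tensor Assoc_nat LUnit_nat
      RUnit_nat pentagon triangle is_iso_M; fail)+

lemma forgetful_strict_monoidal: "strict_monoidal_functor M C forget_obj forget_arr"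
  by unfold_locales
    (auto simp: forget_obj_def forget_arr_def split_beta elim!: Arr_M_cases Hom_M_cases)

end

theorem corollary2p23:
  fixes C :: "('o, 'm) braided_monoidal_category" (structure)
    and A :: 'o and t e :: 'm
  assumes "braided_monoidal_category C"
    and "counital_fusion_morphism C A t e"
    and "split_epi C e"
    and "split_epi C ((fusion_mult C A t e \<otimes> \<one> A) \<cdot> (inv (\<b> A A) \<otimes> \<one> A) \<cdot> on_last_two C A A A t)"
  shows "\<exists>M :: ('o \<times> 'm, ('o, 'm) module_arrow) monoidal_category.
    monoidal_structure_on (module_category C A t e) M \<and>
    strict_monoidal_functor M C forget_obj forget_arr"
proof -
  interpret monoidal_fusion C A t e
    using assms by (simp add: monoidal_fusion_def counital_fusion_def counital_fusion_axioms_def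
        monoidal_fusion_axioms_def)
  have "category.truncate M = module_category C A t e"
    by (simp add: module_monoidal_category_def category.truncate_def)
  then show ?thesis
    unfolding monoidal_structure_on_def
    using modules.monoidal_category_axioms forgetful_strict_monoidal by blast
qed

end
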